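(* Suppose $\psi(M_1)\neq 0$ and let $W_\psi$ be the universal Whittaker module of type $\psi$ for $\mathfrak{sv}$, with cyclic Whittaker vector $w=1\otimes 1$. Then $v\in W_\psi$ is a Whittaker vector (that is, $xv=\psi(x)v$ for all $x\in\mathfrak{sv}^+$) if and only if $v=uw$ for some $u\in\mathbb{C}[M_0]$.
   Context: The Schrödinger-Virasoro algebra $\mathfrak{sv}$ is the complex Lie algebra with basis $\{L_n,M_n,Y_{n+\frac12}\mid n\in\mathbb{Z}\}$ and brackets, for $m,n\in\mathbb{Z}$: $[L_m,L_n]=(n-m)L_{m+n}$, $[L_m,M_n]=nM_{m+n}$, $[L_m,Y_{n+\frac12}]=(n+\frac{1-m}{2})Y_{m+n+\frac12}$, $[Y_{m+\frac12},Y_{n+\frac12}]=(n-m)M_{m+n+1}$, $[M_m,M_n]=[M_m,Y_{n+\frac12}]=0$. The element $M_0$ is central. Put $\mathfrak{sv}^+=\mathrm{span}_{\mathbb{C}}\{L_n,M_n,Y_{m+\frac12}\mid n\geq 1,\ m\geq 0\}$. Let $\psi:\mathfrak{sv}^+\to\mathbb{C}$ be a Lie algebra homomorphism; throughout, $\psi(L_n)=0$ for $n\geq 3$, $\psi(M_m)=0$ for $m\geq 2$, and $\psi(Y_{\frac12+k})=0$ for $k\geq 1$. Let $\mathbb{C}_\psi$ be the one-dimensional $\mathfrak{sv}^+$-module with $x\alpha=\psi(x)\alpha$. The universal Whittaker module of type $\psi$ is $W_\psi=U(\mathfrak{sv})\otimes_{U(\mathfrak{sv}^+)}\mathbb{C}_\psi$.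 $\mathbb{C}[M_0]\subset U(\mathfrak{sv})$ is the polynomial algebra generated by $M_0$. *)

theory Defs
  imports Complex_Main "HOL-Library.Poly_Mapping"
begin

section \<open>Complex vector spaces, associative algebras and Lie algebras\<close>

class complex_vs = ab_group_add +
  fixes cscale :: "complex \<Rightarrow> 'a \<Rightarrow> 'a"  (infixr \<open>*\<^sub>C\<close> 75)
  assumes cscale_add_right: "c *\<^sub>C (x + y) = c *\<^sub>C x + c *\<^sub>C y"
    and cscale_add_left: "(c + d) *\<^sub>C x = c *\<^sub>C x + d *\<^sub>C x"
    and cscale_cscale: "c *\<^sub>C d *\<^sub>C x = (c * d) *\<^sub>C x"
    and cscale_one: "1 *\<^sub>C x = x"

global_interpretation cvs: vector_space "cscale :: complex \<Rightarrow> 'a \<Rightarrow> 'a::complex_vs"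
  by unfold_locales (rule cscale_add_right cscale_add_left cscale_cscale cscale_one)+

class complex_algebra_1 = complex_vs + ring_1 +
  assumes cscale_mult_left: "(c *\<^sub>C x) * y = c *\<^sub>C (x * y)"
    and cscale_mult_right: "x * (c *\<^sub>C y) = c *\<^sub>C (x * y)"

class complex_lie_algebra = complex_vs +
  fixes bracket :: "'a \<Rightarrow> 'a \<Rightarrow> 'a"
  assumes bracket_add_left: "bracket (x + y) z = bracket x z + bracket y z"
    and bracket_add_right: "bracket x (y + z) = bracket x y + bracket x z"
    and bracket_cscale_left: "bracket (c *\<^sub>C x) y = c *\<^sub>C bracket x y"
    and bracket_cscale_right: "bracket x (c *\<^sub>C y) = c *\<^sub>C bracket x y"
    and bracket_self: "bracket x x = 0"
    and jacobi: "bracket x (bracket y z) + bracket y (bracket z x) + bracket z (bracket x y) = 0"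

instantiation complex :: complex_algebra_1
begin
definition cscale_complex :: "complex \<Rightarrow> complex \<Rightarrow> complex" where "cscale_complex = (*)"
instance by standard (simp_all add: cscale_complex_def algebra_simps)
end

lemma linear_cscale_iff:
  "Vector_Spaces.linear cscale cscale (f :: 'a::complex_vs \<Rightarrow> 'b::complex_vs) \<longleftrightarrow>
     (\<forall>x y. f (x + y) = f x + f y) \<and> (\<forall>c x. f (c *\<^sub>C x) = c *\<^sub>C f x)"
  by (simp add: Vector_Spaces.linear_iff cvs.vector_space_axioms)

text \<open>An associative algebra is regarded as a Lie algebra under the commutator. For a commutative
  algebra such as the complex numbers the commutator is zero.\<close>

definition lie_hom :: "('l::complex_lie_algebra \<Rightarrow> 'a::complex_algebra_1) \<Rightarrow> bool" where
  "lie_hom \<phi> \<longleftrightarrow> Vector_Spaces.linear cscale cscale \<phi> \<and>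
     (\<forall>x y. \<phi> (bracket x y) = \<phi> x * \<phi> y - \<phi> y * \<phi> x)"

definition alg_hom :: "('a::complex_algebra_1 \<Rightarrow> 'b::complex_algebra_1) \<Rightarrow> bool" where
  "alg_hom h \<longleftrightarrow> Vector_Spaces.linear cscale cscale h \<and> h 1 = 1 \<and>
     (\<forall>x y. h (x * y) = h x * h y)"

definition is_subalgebra :: "'a::complex_algebra_1 set \<Rightarrow> bool" where
  "is_subalgebra S \<longleftrightarrow> cvs.subspace S \<and> 1 \<in> S \<and> (\<forall>x\<in>S. \<forall>y\<in>S. x * y \<in> S)"

definition is_ideal :: "'a::ring_1 set \<Rightarrow> bool" where
  "is_ideal I \<longleftrightarrow> 0 \<in> I \<and> (\<forall>x\<in>I. \<forall>y\<in>I. x + y \<in> I) \<and> (\<forall>x\<in>I. \<forall>r. r * x \<in> I \<and> x * r \<in> I)"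

definition lin_ext :: "('a \<Rightarrow> 'b) \<Rightarrow> ('a \<Rightarrow>\<^sub>0 complex) \<Rightarrow> 'b::complex_vs" where
  "lin_ext f p = (\<Sum>a\<in>Poly_Mapping.keys p. Poly_Mapping.lookup p a *\<^sub>C f a)"

lemma lin_ext_superset:
  assumes "finite S" "Poly_Mapping.keys p \<subseteq> S"
  shows "lin_ext f p = (\<Sum>a\<in>S. Poly_Mapping.lookup p a *\<^sub>C f a)"
  unfolding lin_ext_def using assms
  by (intro sum.mono_neutral_left) (auto simp: in_keys_iff)

lemma lin_ext_add: "lin_ext f (p + q) = lin_ext f p + lin_ext f q"
proof -
  let ?S = "Poly_Mapping.keys p \<union> Poly_Mapping.keys q"
  have "Poly_Mapping.keys (p + q) \<subseteq> ?S" by (rule keys_add)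
  then show ?thesis
    by (simp add: lin_ext_superset[of ?S] lookup_add cscale_add_left sum.distrib)
qed

lemma lin_ext_zero [simp]: "lin_ext f 0 = 0"
  by (simp add: lin_ext_def)

lemma lin_ext_single [simp]: "lin_ext f (Poly_Mapping.single a c) = c *\<^sub>C f a"
  by (simp add: lin_ext_def)

lemma lin_ext_uminus: "lin_ext f (- p) = - lin_ext f p"
  using lin_ext_add[of f p "- p"] by (simp add: minus_unique)

lemma lin_ext_diff: "lin_ext f (p - q) = lin_ext f p - lin_ext f q"
  using lin_ext_add[of f p "- q"] by (simp add: lin_ext_uminus)

lemma poly_mapping_single_induct [case_names zero add single]:
  assumes "P 0" "\<And>p q. P p \<Longrightarrow> P q \<Longrightarrow> P (p + q)" "\<And>a c. P (Poly_Mapping.single a c)"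
  shows "P (p :: 'a \<Rightarrow>\<^sub>0 'b::comm_monoid_add)"
proof (induction p rule: update_induct)
  case const show ?case by (rule assms(1))
next
  case (update f a b)
  have "Poly_Mapping.update a b f = f + Poly_Mapping.single a b"
    using update(1)
    by (intro poly_mapping_eqI) (auto simp: lookup_update lookup_add lookup_single in_keys_iff)
  then show ?case using assms(2)[OF update(3) assms(3)] by simp
qed

section \<open>The universal enveloping algebra\<close>

text \<open>The free associative algebra on a set is the monoid algebra of the free monoid on it;
  polynomial mappings into the complex numbers with keys in a monoid carry the convolution product.\<close>

datatype 'a free_monoid = Word (letters: "'a list")

instantiation free_monoid :: (type) monoid_add
begin
definition zero_free_monoid :: "'a free_monoid" where "0 = Word []"
definition plus_free_monoid :: "'a free_monoid \<Rightarrow> 'a free_monoid \<Rightarrow> 'a free_monoid" where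
  "v + w = Word (letters v @ letters w)"
instance by standard (simp_all add: zero_free_monoid_def plus_free_monoid_def)
end

type_synonym 'a free_alg = "'a free_monoid \<Rightarrow>\<^sub>0 complex"

definition gen :: "'a \<Rightarrow> 'a free_alg" where
  "gen x = Poly_Mapping.single (Word [x]) 1"

definition free_eval :: "('a \<Rightarrow> 'b) \<Rightarrow> 'a free_alg \<Rightarrow> 'b::complex_algebra_1" where
  "free_eval \<phi> = lin_ext (\<lambda>w. prod_list (map \<phi> (letters w)))"

lemma single_zero_commute: "p * Poly_Mapping.single 0 c = Poly_Mapping.single 0 c * (p :: 'a free_alg)"
  by (induction p rule: poly_mapping_single_induct)
     (simp_all add: algebra_simps mult_single)

lemma free_eval_gen: "free_eval \<phi> (gen x) = \<phi> x"
  by (simp add: free_eval_def gen_def cscale_one)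

lemma free_eval_scalar: "free_eval \<phi> (Poly_Mapping.single 0 c) = c *\<^sub>C 1"
  by (simp add: free_eval_def zero_free_monoid_def)

lemma free_eval_one: "free_eval \<phi> 1 = 1"
  using free_eval_scalar[of \<phi> 1] by (simp add: cscale_one)

lemma free_eval_mult: "free_eval \<phi> (p * q) = free_eval \<phi> p * free_eval \<phi> q"
proof (induction p rule: poly_mapping_single_induct)
  case (single v c)
  show ?case
    by (induction q rule: poly_mapping_single_induct)
       (simp_all add: free_eval_def lin_ext_add algebra_simps mult_single plus_free_monoid_def
          cscale_mult_left cscale_mult_right cscale_cscale)
qed (simp_all add: free_eval_def lin_ext_add algebra_simps)

text \<open>The second family, with the first, turns the free algebra on the underlying set of the Lie
  algebra into the tensor algebra of its underlying vector space.\<close>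

definition uea_relators :: "'l::complex_lie_algebra free_alg set" where
  "uea_relators =
     {gen (x + y) - gen x - gen y | x y. True} \<union>
     {gen (c *\<^sub>C x) - Poly_Mapping.single 0 c * gen x | c x. True} \<union>
     {gen x * gen y - gen y * gen x - gen (bracket x y) | x y. True}"

definition uea_null :: "'l::complex_lie_algebra free_alg set" where
  "uea_null = is_ideal hull uea_relators"

lemma is_ideal_uea_null: "is_ideal uea_null"
  unfolding uea_null_def by (rule hull_in) (auto simp: is_ideal_def)

lemma uea_null_zero: "0 \<in> uea_null"
  and uea_null_add: "p \<in> uea_null \<Longrightarrow> q \<in> uea_null \<Longrightarrow> p + q \<in> uea_null"
  and uea_null_mult_left: "p \<in> uea_null \<Longrightarrow> r * p \<in> uea_null"
  and uea_null_mult_right: "p \<in> uea_null \<Longrightarrow> p * r \<in> uea_null"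
  using is_ideal_uea_null by (auto simp: is_ideal_def)

lemma uea_null_uminus: "p \<in> uea_null \<Longrightarrow> - p \<in> uea_null"
  using uea_null_mult_left[of p "- 1"] by simp

lemma eq_refl_uea_null: "p = q \<Longrightarrow> p - q \<in> uea_null"
  by (simp add: uea_null_zero)

lemma uea_relators_null: "p \<in> uea_relators \<Longrightarrow> p \<in> uea_null"
  unfolding uea_null_def by (rule hull_inc)

lemma free_eval_null:
  assumes "lie_hom \<phi>" "p \<in> uea_null"
  shows "free_eval \<phi> p = 0"
proof -
  interpret Vector_Spaces.linear cscale cscale \<phi>
    using assms(1) by (simp add: lie_hom_def)
  have "is_ideal {p. free_eval \<phi> p = 0}"
    by (auto simp: is_ideal_def free_eval_mult) (simp_all add: free_eval_def lin_ext_add)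
  moreover have "uea_relators \<subseteq> {p. free_eval \<phi> p = 0}"
  proof -
    have d: "free_eval \<phi> (p - q) = free_eval \<phi> p - free_eval \<phi> q" for p q
      by (simp add: free_eval_def lin_ext_diff)
    show ?thesis
      using assms(1)
      by (auto simp: uea_relators_def d free_eval_mult free_eval_gen free_eval_scalar add scale
          cscale_mult_left lie_hom_def)
  qed
  ultimately show ?thesis
    using assms(2) hull_minimal[of uea_relators "{p. free_eval \<phi> p = 0}" is_ideal]
    by (auto simp: uea_null_def)
qed

quotient_type (overloaded) 'l uea = "'l::complex_lie_algebra free_alg" / "\<lambda>p q. p - q \<in> uea_null"
proof (rule equivpI)
  show "reflp (\<lambda>p q. p - q \<in> (uea_null :: 'l free_alg set))"
    by (auto simp: reflp_def uea_null_zero)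
  show "symp (\<lambda>p q. p - q \<in> (uea_null :: 'l free_alg set))"
    by (auto simp: symp_def dest: uea_null_uminus)
  show "transp (\<lambda>p q. p - q \<in> (uea_null :: 'l free_alg set))"
    by (auto simp: transp_def dest: uea_null_add)
qed

instantiation uea :: (complex_lie_algebra) complex_algebra_1
begin

lift_definition zero_uea :: "'a uea" is 0 .
lift_definition one_uea :: "'a uea" is 1 .

lift_definition plus_uea :: "'a uea \<Rightarrow> 'a uea \<Rightarrow> 'a uea" is "(+)"
  using uea_null_add by (fastforce simp: algebra_simps)

lift_definition uminus_uea :: "'a uea \<Rightarrow> 'a uea" is uminus
  using uea_null_uminus by fastforce

lift_definition minus_uea :: "'a uea \<Rightarrow> 'a uea \<Rightarrow> 'a uea" is "(-)"
proof -
  fix p p' q q' :: "'a free_alg"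
  assume "p - p' \<in> uea_null" "q - q' \<in> uea_null"
  then have "(p - p') + - (q - q') \<in> uea_null" by (intro uea_null_add uea_null_uminus)
  then show "p - q - (p' - q') \<in> uea_null" by (simp add: algebra_simps)
qed

lift_definition times_uea :: "'a uea \<Rightarrow> 'a uea \<Rightarrow> 'a uea" is "(*)"
proof -
  fix p p' q q' :: "'a free_alg"
  assume "p - p' \<in> uea_null" "q - q' \<in> uea_null"
  then have "(p - p') * q + p' * (q - q') \<in> uea_null"
    by (intro uea_null_add uea_null_mult_left uea_null_mult_right)
  then show "p * q - p' * q' \<in> uea_null" by (simp add: algebra_simps)
qed

lift_definition cscale_uea :: "complex \<Rightarrow> 'a uea \<Rightarrow> 'a uea" is
  "\<lambda>c p. Poly_Mapping.single 0 c * p"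
  by (simp add: uea_null_mult_left flip: right_diff_distrib)

instance
proof
  show "(0::'a uea) \<noteq> 1"
  proof (transfer, rule notI)
    assume "0 - 1 \<in> (uea_null :: 'a free_alg set)"
    moreover have "lie_hom (\<lambda>_::'a. 0::complex)"
      by (simp add: lie_hom_def linear_cscale_iff)
    ultimately have "free_eval (\<lambda>_::'a. 0::complex) (0 - 1) = 0"
      by (intro free_eval_null)
    moreover have "free_eval (\<lambda>_::'a. 0::complex) (0 - 1) = - 1"
      by (simp only: free_eval_def diff_0 lin_ext_uminus) (simp only: free_eval_one flip: free_eval_def)
    ultimately show False by simp
  qed
  note eq = eq_refl_uea_null
  fix a b c :: "'a uea" and z z' :: complex
  show "a + b + c = a + (b + c)" by transfer (rule eq, rule add.assoc)
  show "a + b = b + a" by transfer (rule eq, rule add.commute)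
  show "0 + a = a" by transfer (rule eq, rule add_0)
  show "- a + a = 0" by transfer (rule eq, rule add.left_inverse)
  show "a - b = a + - b" by transfer (rule eq, rule diff_conv_add_uminus)
  show "a * b * c = a * (b * c)" by transfer (rule eq, rule mult.assoc)
  show "1 * a = a" by transfer (rule eq, rule mult_1_left)
  show "a * 1 = a" by transfer (rule eq, rule mult_1_right)
  show "(a + b) * c = a * c + b * c" by transfer (rule eq, rule distrib_right)
  show "a * (b + c) = a * b + a * c" by transfer (rule eq, rule distrib_left)
  show "z *\<^sub>C (a + b) = z *\<^sub>C a + z *\<^sub>C b" by transfer (rule eq, rule distrib_left)
  show "(z + z') *\<^sub>C a = z *\<^sub>C a + z' *\<^sub>C a"
    by transfer (rule eq, simp only: single_add distrib_right)
  show "z *\<^sub>C z' *\<^sub>C a = (z * z') *\<^sub>C a"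
    by transfer (rule eq, simp add: mult_single flip: mult.assoc)
  show "1 *\<^sub>C a = a" by transfer (rule eq, simp)
  show "(z *\<^sub>C a) * b = z *\<^sub>C (a * b)" by transfer (rule eq, rule mult.assoc)
  show "a * (z *\<^sub>C b) = z *\<^sub>C (a * b)"
    by transfer (rule eq, simp only: single_zero_commute flip: mult.assoc)
qed

end

lift_definition uea_of :: "'l::complex_lie_algebra \<Rightarrow> 'l uea" is gen .

lemma lie_hom_uea_of: "lie_hom uea_of"
  unfolding lie_hom_def linear_cscale_iff
proof (intro conjI allI)
  fix x y :: 'a and c :: complex
  have "gen (x + y) - gen x - gen y \<in> uea_relators"
    unfolding uea_relators_def by (rule UnI1, rule UnI1) blast
  then show "uea_of (x + y) = uea_of x + uea_of y"
    by transfer (simp only: uea_relators_null diff_diff_eq[symmetric])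
  have "gen (c *\<^sub>C x) - Poly_Mapping.single 0 c * gen x \<in> uea_relators"
    unfolding uea_relators_def by (rule UnI1, rule UnI2) blast
  then show "uea_of (c *\<^sub>C x) = c *\<^sub>C uea_of x"
    by transfer (rule uea_relators_null)
  have "gen x * gen y - gen y * gen x - gen (bracket x y) \<in> uea_relators"
    unfolding uea_relators_def by (rule UnI2) blast
  then have "uea_of x * uea_of y - uea_of y * uea_of x = uea_of (bracket x y)"
    by transfer (rule uea_relators_null)
  then show "uea_of (bracket x y) = uea_of x * uea_of y - uea_of y * uea_of x" ..
qed

text \<open>The extension of a Lie algebra homomorphism into an associative algebra to the enveloping
  algebra, given by its universal property. It is only meaningful when the argument is a
  Lie algebra homomorphism, since only then the choice of a representative is irrelevant.\<close>

definition uea_lift :: "('l::complex_lie_algebra \<Rightarrow> 'a::complex_algebra_1) \<Rightarrow> 'l uea \<Rightarrow> 'a" where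
  "uea_lift \<phi> a = free_eval \<phi> (rep_uea a)"

lemma uea_lift_abs:
  assumes "lie_hom \<phi>"
  shows "uea_lift \<phi> (abs_uea p) = free_eval \<phi> p"
proof -
  have "rep_uea (abs_uea p) - p \<in> uea_null"
    by (rule Quotient3_rep_abs[OF Quotient3_uea]) (simp add: uea_null_zero)
  from free_eval_null[OF assms this] show ?thesis
    by (simp add: uea_lift_def free_eval_def lin_ext_diff)
qed

lemma alg_hom_uea_lift:
  assumes "lie_hom \<phi>"
  shows "alg_hom (uea_lift \<phi>)"
proof -
  note lift = uea_lift_abs[OF assms]
  have add: "uea_lift \<phi> (a + b) = uea_lift \<phi> a + uea_lift \<phi> b" for a b
    by (induction a rule: uea.abs_induct, induction b rule: uea.abs_induct)
       (simp add: lift plus_uea.abs_eq free_eval_def lin_ext_add)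
  have mult: "uea_lift \<phi> (a * b) = uea_lift \<phi> a * uea_lift \<phi> b" for a b
    by (induction a rule: uea.abs_induct, induction b rule: uea.abs_induct)
       (simp add: lift times_uea.abs_eq free_eval_mult)
  have scale: "uea_lift \<phi> (c *\<^sub>C a) = c *\<^sub>C uea_lift \<phi> a" for c a
    by (induction a rule: uea.abs_induct)
       (simp add: lift cscale_uea.abs_eq free_eval_mult free_eval_scalar cscale_mult_left)
  have one: "uea_lift \<phi> 1 = 1"
    by (simp add: lift one_uea.abs_eq free_eval_one)
  show ?thesis
    by (simp add: alg_hom_def linear_cscale_iff add mult scale one)
qed

lemma uea_lift_uea_of: "lie_hom \<phi> \<Longrightarrow> uea_lift \<phi> (uea_of x) = \<phi> x"
  by (simp add: uea_of.abs_eq uea_lift_abs free_eval_gen)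

section \<open>Tensor products over a ring\<close>

text \<open>The tensor product of a right module \<open>'m\<close> and a left module \<open>'n\<close> over \<open>'r\<close>, the actions
  being \<open>ract\<close> and \<open>lact\<close>, is the free abelian group on pairs modulo the following subgroup.\<close>

definition is_subgroup :: "'a::ab_group_add set \<Rightarrow> bool" where
  "is_subgroup S \<longleftrightarrow> 0 \<in> S \<and> (\<forall>x\<in>S. \<forall>y\<in>S. x - y \<in> S)"

definition tensor_null ::
  "('m::ab_group_add \<Rightarrow> 'r \<Rightarrow> 'm) \<Rightarrow> ('r \<Rightarrow> 'n::ab_group_add \<Rightarrow> 'n) \<Rightarrow> ('m \<times> 'n \<Rightarrow>\<^sub>0 int) set" where
  "tensor_null ract lact = is_subgroup hull
     ({frag_of (m + m', n) - frag_of (m, n) - frag_of (m', n) | m m' n. True} \<union>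
      {frag_of (m, n + n') - frag_of (m, n) - frag_of (m, n') | m n n'. True} \<union>
      {frag_of (ract m r, n) - frag_of (m, lact r n) | m r n. True})"

definition tensor_rel ::
  "('m::ab_group_add \<Rightarrow> 'r \<Rightarrow> 'm) \<Rightarrow> ('r \<Rightarrow> 'n::ab_group_add \<Rightarrow> 'n) \<Rightarrow> ('m \<times> 'n \<Rightarrow>\<^sub>0 int) rel" where
  "tensor_rel ract lact = {(f, g). f - g \<in> tensor_null ract lact}"

definition tensor_space ::
  "('m::ab_group_add \<Rightarrow> 'r \<Rightarrow> 'm) \<Rightarrow> ('r \<Rightarrow> 'n::ab_group_add \<Rightarrow> 'n) \<Rightarrow> ('m \<times> 'n \<Rightarrow>\<^sub>0 int) set set" where
  "tensor_space ract lact = UNIV // tensor_rel ract lact"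

definition pure_tensor ::
  "('m::ab_group_add \<Rightarrow> 'r \<Rightarrow> 'm) \<Rightarrow> ('r \<Rightarrow> 'n::ab_group_add \<Rightarrow> 'n) \<Rightarrow> 'm \<Rightarrow> 'n \<Rightarrow>
     ('m \<times> 'n \<Rightarrow>\<^sub>0 int) set" where
  "pure_tensor ract lact m n = tensor_rel ract lact `` {frag_of (m, n)}"

text \<open>The endomorphism \<open>h \<otimes> id\<close> of the tensor product, for \<open>h\<close> an endomorphism of the right
  module \<open>'m\<close>.\<close>

definition tensor_map ::
  "('m::ab_group_add \<Rightarrow> 'r \<Rightarrow> 'm) \<Rightarrow> ('r \<Rightarrow> 'n::ab_group_add \<Rightarrow> 'n) \<Rightarrow> ('m \<Rightarrow> 'm) \<Rightarrow>
     ('m \<times> 'n \<Rightarrow>\<^sub>0 int) set \<Rightarrow> ('m \<times> 'n \<Rightarrow>\<^sub>0 int) set" where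
  "tensor_map ract lact h X =
     (\<Union>f\<in>X. tensor_rel ract lact `` {frag_extend (\<lambda>(m, n). frag_of (h m, n)) f})"

lemma is_subgroup_tensor_null: "is_subgroup (tensor_null ract lact)"
  unfolding tensor_null_def by (rule hull_in) (auto simp: is_subgroup_def)

lemma equiv_tensor_rel: "equiv UNIV (tensor_rel ract lact)"
proof -
  have 0: "0 \<in> tensor_null ract lact"
    and d: "\<And>x y. x \<in> tensor_null ract lact \<Longrightarrow> y \<in> tensor_null ract lact \<Longrightarrow> x - y \<in> tensor_null ract lact"
    using is_subgroup_tensor_null[of ract lact] by (auto simp: is_subgroup_def)
  show ?thesis
  proof (rule equivI)
    show "refl (tensor_rel ract lact)"
      by (auto simp: refl_on_def tensor_rel_def 0)
    show "sym (tensor_rel ract lact)"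
      using d[OF 0] by (fastforce simp: sym_def tensor_rel_def)
    show "trans (tensor_rel ract lact)"
    proof (rule transI)
      fix f g h assume "(f, g) \<in> tensor_rel ract lact" "(g, h) \<in> tensor_rel ract lact"
      then have "(f - g) - (0 - (g - h)) \<in> tensor_null ract lact"
        by (intro d[OF _ d[OF 0]]) (auto simp: tensor_rel_def)
      then show "(f, h) \<in> tensor_rel ract lact"
        by (simp add: tensor_rel_def)
    qed
  qed simp
qed

lemma tensor_map_class:
  assumes add: "\<And>m m'. h (m + m') = h m + h m'" and ract: "\<And>m r. h (ract m r) = ract (h m) r"
  shows "tensor_map ract lact h (tensor_rel ract lact `` {f}) =
           tensor_rel ract lact `` {frag_extend (\<lambda>(m, n). frag_of (h m, n)) f}"
proof -
  let ?e = "frag_extend (\<lambda>(m, n). frag_of (h m, n))" and ?N = "tensor_null ract lact"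
  have null: "?e f \<in> ?N" if "f \<in> ?N" for f
  proof -
    let ?R = "{frag_of (m + m', n) - frag_of (m, n) - frag_of (m', n) | m m' n. True} \<union>
      {frag_of (m, n + n') - frag_of (m, n) - frag_of (m, n') | m n n'. True} \<union>
      {frag_of (ract m r, n) - frag_of (m, lact r n) | m r n. True}"
    have N: "?N = is_subgroup hull ?R" by (simp only: tensor_null_def)
    have "is_subgroup {f. ?e f \<in> ?N}"
      using is_subgroup_tensor_null[of ract lact] by (auto simp: is_subgroup_def frag_extend_diff)
    moreover have "?R \<subseteq> {f. ?e f \<in> ?N}"
    proof
      fix f assume "f \<in> ?R"
      then consider
          (add_left) m m' n where "f = frag_of (m + m', n) - frag_of (m, n) - frag_of (m', n)"
        | (add_right) m n n' where "f = frag_of (m, n + n') - frag_of (m, n) - frag_of (m, n')"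
        | (balanced) m r n where "f = frag_of (ract m r, n) - frag_of (m, lact r n)"
        by blast
      then have "?e f \<in> ?R"
      proof cases
        case add_left
        then have "?e f = frag_of (h m + h m', n) - frag_of (h m, n) - frag_of (h m', n)"
          by (simp add: frag_extend_diff add)
        then show ?thesis by blast
      next
        case add_right
        then have "?e f = frag_of (h m, n + n') - frag_of (h m, n) - frag_of (h m, n')"
          by (simp add: frag_extend_diff)
        then show ?thesis by blast
      next
        case balanced
        then have "?e f = frag_of (ract (h m) r, n) - frag_of (h m, lact r n)"
          by (simp add: frag_extend_diff ract)
        then show ?thesis by blast
      qed
      then show "f \<in> {f. ?e f \<in> ?N}" by (simp only: N mem_Collect_eq hull_inc)
    qed
    ultimately show ?thesis
      using that hull_minimal[of ?R "{f. ?e f \<in> ?N}" is_subgroup] unfolding N by blast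
  qed
  have eq: "tensor_rel ract lact `` {?e g} = tensor_rel ract lact `` {?e f}"
    if "g \<in> tensor_rel ract lact `` {f}" for g
    using that null[of "f - g"]
    by (intro equiv_class_eq[OF equiv_tensor_rel, symmetric]) (simp add: tensor_rel_def frag_extend_diff)
  have "f \<in> tensor_rel ract lact `` {f}"
    using equiv_class_self[OF equiv_tensor_rel] by blast
  then show ?thesis unfolding tensor_map_def by (rule UN_constant_eq) (use eq in blast)
qed

section \<open>The Schroedinger-Virasoro algebra\<close>

text \<open>The index \<open>Ind_Y n\<close> stands for the basis vector with the half-integral label \<open>n + 1/2\<close>.\<close>

datatype sv_index = Ind_L int | Ind_M int | Ind_Y int

typedef sv = "UNIV :: (sv_index \<Rightarrow>\<^sub>0 complex) set"
  morphisms sv_coords sv_of_coords ..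

setup_lifting type_definition_sv

lemma lookup_map_scale:
  "Poly_Mapping.lookup (Poly_Mapping.map ((*) c) p) a = c * Poly_Mapping.lookup p a"
  for c :: complex
  by (simp add: Poly_Mapping.map.rep_eq when_def)

instantiation sv :: complex_vs
begin
lift_definition zero_sv :: sv is 0 .
lift_definition plus_sv :: "sv \<Rightarrow> sv \<Rightarrow> sv" is "(+)" .
lift_definition minus_sv :: "sv \<Rightarrow> sv \<Rightarrow> sv" is "(-)" .
lift_definition uminus_sv :: "sv \<Rightarrow> sv" is uminus .
lift_definition cscale_sv :: "complex \<Rightarrow> sv \<Rightarrow> sv" is "\<lambda>c. Poly_Mapping.map ((*) c)" .
instance
proof
qed (transfer, rule poly_mapping_eqI, simp add: lookup_add lookup_minus lookup_map_scale algebra_simps)+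
end

lift_definition sv_L :: "int \<Rightarrow> sv" is "\<lambda>n. Poly_Mapping.single (Ind_L n) 1" .
lift_definition sv_M :: "int \<Rightarrow> sv" is "\<lambda>n. Poly_Mapping.single (Ind_M n) 1" .
lift_definition sv_Y :: "int \<Rightarrow> sv" is "\<lambda>n. Poly_Mapping.single (Ind_Y n) 1" .

fun sv_basis :: "sv_index \<Rightarrow> sv" where
  "sv_basis (Ind_L n) = sv_L n"
| "sv_basis (Ind_M n) = sv_M n"
| "sv_basis (Ind_Y n) = sv_Y n"

fun basis_bracket :: "sv_index \<Rightarrow> sv_index \<Rightarrow> sv" where
  "basis_bracket (Ind_L m) (Ind_L n) = of_int (n - m) *\<^sub>C sv_L (m + n)"
| "basis_bracket (Ind_L m) (Ind_M n) = of_int n *\<^sub>C sv_M (m + n)"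
| "basis_bracket (Ind_L m) (Ind_Y n) = (of_int n + (1 - of_int m) / 2) *\<^sub>C sv_Y (m + n)"
| "basis_bracket (Ind_Y m) (Ind_Y n) = of_int (n - m) *\<^sub>C sv_M (m + n + 1)"
| "basis_bracket (Ind_M n) (Ind_L m) = - (of_int n *\<^sub>C sv_M (m + n))"
| "basis_bracket (Ind_Y n) (Ind_L m) = - ((of_int n + (1 - of_int m) / 2) *\<^sub>C sv_Y (m + n))"
| "basis_bracket (Ind_M m) (Ind_M n) = 0"
| "basis_bracket (Ind_M m) (Ind_Y n) = 0"
| "basis_bracket (Ind_Y n) (Ind_M m) = 0"

definition sv_bracket :: "sv \<Rightarrow> sv \<Rightarrow> sv" where
  "sv_bracket x y =
     lin_ext (\<lambda>a. lin_ext (\<lambda>b. basis_bracket a b) (sv_coords y)) (sv_coords x)"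

lemma lin_ext_coords_add: "lin_ext f (sv_coords (x + y)) = lin_ext f (sv_coords x) + lin_ext f (sv_coords y)"
  by (simp add: plus_sv.rep_eq lin_ext_add)

lemma lin_ext_coords_cscale: "lin_ext f (sv_coords (c *\<^sub>C x)) = c *\<^sub>C lin_ext f (sv_coords x)"
proof -
  have "Poly_Mapping.keys (sv_coords (c *\<^sub>C x)) \<subseteq> Poly_Mapping.keys (sv_coords x)"
    by (auto simp: cscale_sv.rep_eq in_keys_iff lookup_map_scale)
  moreover have "Poly_Mapping.lookup (sv_coords (c *\<^sub>C x)) a = c * Poly_Mapping.lookup (sv_coords x) a" for a
    by (simp add: cscale_sv.rep_eq lookup_map_scale)
  ultimately show ?thesis
    by (simp add: lin_ext_superset[of "Poly_Mapping.keys (sv_coords x)"] cvs.scale_sum_right cscale_cscale)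
qed

lemma sv_induct [case_names add scale basis]:
  assumes "\<And>x y. P x \<Longrightarrow> P y \<Longrightarrow> P (x + y)" "\<And>c x. P x \<Longrightarrow> P (c *\<^sub>C x)" "\<And>a. P (sv_basis a)"
  shows "P x"
proof -
  have single_coords: "sv_of_coords (Poly_Mapping.single a c) = c *\<^sub>C sv_basis a" for a c
    by (cases a) (simp_all add: sv_L.abs_eq sv_M.abs_eq sv_Y.abs_eq cscale_sv.abs_eq map_single)
  have "P (sv_of_coords p)" for p
  proof (induction p rule: poly_mapping_single_induct)
    case zero
    have "sv_of_coords 0 = 0 *\<^sub>C sv_basis (Ind_L 0)"
      by (simp add: zero_sv_def)
    then show ?case using assms(2)[OF assms(3), of 0] by metis
  next
    case (add p q)
    show ?case using assms(1)[OF add] by (simp add: plus_sv.abs_eq)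
  next
    case (single a c)
    show ?case unfolding single_coords by (intro assms)
  qed
  from this[of "sv_coords x"] show ?thesis by (simp add: sv_coords_inverse)
qed

lemma sv_bracket_add_left: "sv_bracket (x + y) z = sv_bracket x z + sv_bracket y z"
  by (simp add: sv_bracket_def lin_ext_coords_add)

lemma sv_bracket_cscale_left: "sv_bracket (c *\<^sub>C x) y = c *\<^sub>C sv_bracket x y"
  by (simp add: sv_bracket_def lin_ext_coords_cscale)

lemma sv_bracket_add_right: "sv_bracket x (y + z) = sv_bracket x y + sv_bracket x z"
  by (simp add: sv_bracket_def lin_ext_coords_add)
     (simp add: lin_ext_def cscale_add_right sum.distrib)

lemma sv_bracket_cscale_right: "sv_bracket x (c *\<^sub>C y) = c *\<^sub>C sv_bracket x y"
  by (simp add: sv_bracket_def lin_ext_coords_cscale)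
     (simp add: lin_ext_def cvs.scale_sum_right cscale_cscale mult.left_commute)

lemma sv_bracket_basis: "sv_bracket (sv_basis a) (sv_basis b) = basis_bracket a b"
proof -
  have "sv_coords (sv_basis a) = Poly_Mapping.single a 1" for a
    by (cases a) (simp_all add: sv_L.rep_eq sv_M.rep_eq sv_Y.rep_eq)
  then show ?thesis by (simp add: sv_bracket_def cscale_one)
qed

lemma sv_bracket_simps:
  "sv_bracket (sv_L m) (sv_L n) = of_int (n - m) *\<^sub>C sv_L (m + n)"
  "sv_bracket (sv_L m) (sv_M n) = of_int n *\<^sub>C sv_M (m + n)"
  "sv_bracket (sv_L m) (sv_Y n) = (of_int n + (1 - of_int m) / 2) *\<^sub>C sv_Y (m + n)"
  "sv_bracket (sv_Y m) (sv_Y n) = of_int (n - m) *\<^sub>C sv_M (m + n + 1)"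
  "sv_bracket (sv_M n) (sv_L m) = - (of_int n *\<^sub>C sv_M (m + n))"
  "sv_bracket (sv_Y n) (sv_L m) = - ((of_int n + (1 - of_int m) / 2) *\<^sub>C sv_Y (m + n))"
  "sv_bracket (sv_M m) (sv_M n) = 0"
  "sv_bracket (sv_M m) (sv_Y n) = 0"
  "sv_bracket (sv_Y n) (sv_M m) = 0"
  using sv_bracket_basis[of "Ind_L _" "Ind_L _"] sv_bracket_basis[of "Ind_L _" "Ind_M _"]
    sv_bracket_basis[of "Ind_L _" "Ind_Y _"] sv_bracket_basis[of "Ind_Y _" "Ind_Y _"]
    sv_bracket_basis[of "Ind_M _" "Ind_L _"] sv_bracket_basis[of "Ind_Y _" "Ind_L _"]
    sv_bracket_basis[of "Ind_M _" "Ind_M _"] sv_bracket_basis[of "Ind_M _" "Ind_Y _"]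
    sv_bracket_basis[of "Ind_Y _" "Ind_M _"]
  by simp_all

lemma sv_bracket_zero: "sv_bracket 0 x = 0" "sv_bracket x 0 = 0"
  using sv_bracket_cscale_left[of 0 0 x] sv_bracket_cscale_right[of x 0 0] by simp_all

lemma sv_bracket_uminus: "sv_bracket (- x) y = - sv_bracket x y" "sv_bracket x (- y) = - sv_bracket x y"
  using sv_bracket_cscale_left[of "- 1" x y] sv_bracket_cscale_right[of x "- 1" y] by simp_all

lemma sv_bracket_antisym: "sv_bracket x y = - sv_bracket y x"
proof (induction x rule: sv_induct)
  case (basis a)
  show ?case
  proof (induction y rule: sv_induct)
    case (basis b)
    show ?case
      by (cases a; cases b)
         (simp_all add: sv_bracket_simps add.commute cvs.scale_left_diff_distrib)
  qed (simp_all add: sv_bracket_add_left sv_bracket_add_right sv_bracket_cscale_left sv_bracket_cscale_right)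
qed (simp_all add: sv_bracket_add_left sv_bracket_add_right sv_bracket_cscale_left sv_bracket_cscale_right)

lemma sv_jacobi:
  "sv_bracket x (sv_bracket y z) + sv_bracket y (sv_bracket z x) + sv_bracket z (sv_bracket x y) = 0"
  (is "?J x y z = 0")
proof -
  note lin = sv_bracket_add_left sv_bracket_add_right sv_bracket_cscale_left sv_bracket_cscale_right
  have J_add: "?J (x + x') y z = ?J x y z + ?J x' y z" for x x' y z
    by (simp add: lin algebra_simps)
  have J_scale: "?J (c *\<^sub>C x) y z = c *\<^sub>C ?J x y z" for c x y z
    by (simp add: lin cscale_add_right)
  have J_cyc: "?J x y z = ?J y z x" for x y z
    by (simp add: algebra_simps)
  have comb: "c *\<^sub>C x + d *\<^sub>C x = (c + d) *\<^sub>C x" "- (c *\<^sub>C x) = (- c) *\<^sub>C x"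
    "c *\<^sub>C x + (d *\<^sub>C x + y) = (c + d) *\<^sub>C x + y" "c *\<^sub>C x - d *\<^sub>C x = (c - d) *\<^sub>C x"
    for c d and x y :: sv
    by (simp_all add: cscale_add_left cvs.scale_left_diff_distrib add.assoc)
  have basis: "?J (sv_basis a) (sv_basis b) (sv_basis c) = 0" for a b c
    by (cases a; cases b; cases c)
       (simp_all add: sv_bracket_simps lin sv_bracket_zero sv_bracket_uminus cscale_cscale add_ac
          del: of_int_diff of_int_add of_int_mult,
        simp_all only: comb, simp_all,
        simp_all add: algebra_simps add_divide_distrib diff_divide_distrib)
  have one: "?J x (sv_basis b) (sv_basis c) = 0" for x b c
    by (induction x rule: sv_induct) (simp_all only: J_add J_scale basis add_0 cvs.scale_zero_right)
  have two: "?J y x (sv_basis b) = 0" for x b y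
  proof (induction y rule: sv_induct)
    case (basis c)
    show ?case using J_cyc[of "sv_basis c" x "sv_basis b"] one[of x b c] by (rule trans)
  qed (simp_all only: J_add J_scale add_0 cvs.scale_zero_right)
  have "?J z x y = 0"
  proof (induction z rule: sv_induct)
    case (basis c)
    show ?case using J_cyc[of "sv_basis c" x y] two[of x y c] by (rule trans)
  qed (simp_all only: J_add J_scale add_0 cvs.scale_zero_right)
  with J_cyc[of z x y] show ?thesis by (rule trans[OF sym])
qed

instantiation sv :: complex_lie_algebra
begin
definition bracket_sv :: "sv \<Rightarrow> sv \<Rightarrow> sv" where "bracket_sv = sv_bracket"
instance
proof
  fix x y z :: sv and c :: complex
  have "sv_bracket x x + sv_bracket x x = 0"
    by (metis sv_bracket_antisym add.right_inverse)
  then have "(1 + 1) *\<^sub>C sv_bracket x x = 0"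
    by (simp only: cscale_add_left cscale_one)
  then show "bracket x x = 0"
    by (simp add: bracket_sv_def)
  show "bracket x (bracket y z) + bracket y (bracket z x) + bracket z (bracket x y) = 0"
    by (simp add: bracket_sv_def sv_jacobi)
qed (simp_all add: bracket_sv_def sv_bracket_add_left sv_bracket_add_right sv_bracket_cscale_left
      sv_bracket_cscale_right)
end

definition sv_plus_gens :: "sv set" where
  "sv_plus_gens = {sv_L n | n. n \<ge> 1} \<union> {sv_M n | n. n \<ge> 1} \<union> {sv_Y m | m. m \<ge> 0}"

typedef sv_plus = "cvs.span sv_plus_gens"
  morphisms sv_plus_incl to_sv_plus
  using cvs.span_zero by blast

lemma span_sv_plus_gens_bracket:
  assumes "x \<in> cvs.span sv_plus_gens" "y \<in> cvs.span sv_plus_gens"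
  shows "bracket x y \<in> cvs.span sv_plus_gens"
proof -
  have base: "n \<ge> 1 \<Longrightarrow> sv_L n \<in> cvs.span sv_plus_gens" "n \<ge> 1 \<Longrightarrow> sv_M n \<in> cvs.span sv_plus_gens"
    "n \<ge> 0 \<Longrightarrow> sv_Y n \<in> cvs.span sv_plus_gens" for n
    by (auto simp: sv_plus_gens_def intro!: cvs.span_base)
  have gens: "bracket x y \<in> cvs.span sv_plus_gens" if "x \<in> sv_plus_gens" "y \<in> sv_plus_gens" for x y
  proof -
    from that have "(\<exists>n. x = sv_L n \<and> n \<ge> 1) \<or> (\<exists>n. x = sv_M n \<and> n \<ge> 1) \<or> (\<exists>n. x = sv_Y n \<and> n \<ge> 0)"
      by (auto simp: sv_plus_gens_def)
    moreover from that have "(\<exists>n. y = sv_L n \<and> n \<ge> 1) \<or> (\<exists>n. y = sv_M n \<and> n \<ge> 1) \<or> (\<exists>n. y = sv_Y n \<and> n \<ge> 0)"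
      by (auto simp: sv_plus_gens_def)
    ultimately show ?thesis
      by (elim disjE exE conjE; simp only: bracket_sv_def sv_bracket_simps)
         (intro cvs.span_scale cvs.span_neg cvs.span_zero base; simp)+
  qed
  have right: "bracket x y \<in> cvs.span sv_plus_gens" if "x \<in> sv_plus_gens" for x
    using assms(2)
    by (induction y rule: cvs.span_induct_alt)
       (use that in \<open>auto simp: bracket_sv_def sv_bracket_zero sv_bracket_add_right sv_bracket_cscale_right
          intro!: cvs.span_add cvs.span_scale cvs.span_zero gens[unfolded bracket_sv_def]\<close>)
  show ?thesis
    using assms(1)
    by (induction x rule: cvs.span_induct_alt)
       (auto simp: bracket_sv_def sv_bracket_zero sv_bracket_add_left sv_bracket_cscale_left
          intro!: cvs.span_add cvs.span_scale cvs.span_zero right[unfolded bracket_sv_def])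
qed

setup_lifting type_definition_sv_plus

instantiation sv_plus :: complex_lie_algebra
begin
lift_definition zero_sv_plus :: sv_plus is 0 by (rule cvs.span_zero)
lift_definition plus_sv_plus :: "sv_plus \<Rightarrow> sv_plus \<Rightarrow> sv_plus" is "(+)" by (rule cvs.span_add)
lift_definition minus_sv_plus :: "sv_plus \<Rightarrow> sv_plus \<Rightarrow> sv_plus" is "(-)" by (rule cvs.span_diff)
lift_definition uminus_sv_plus :: "sv_plus \<Rightarrow> sv_plus" is uminus by (rule cvs.span_neg)
lift_definition cscale_sv_plus :: "complex \<Rightarrow> sv_plus \<Rightarrow> sv_plus" is cscale by (rule cvs.span_scale)
lift_definition bracket_sv_plus :: "sv_plus \<Rightarrow> sv_plus \<Rightarrow> sv_plus" is bracket
  by (rule span_sv_plus_gens_bracket)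
instance
proof
  fix x y z :: sv_plus and c d :: complex
  show "x + y + z = x + (y + z)" by transfer (rule add.assoc)
  show "x + y = y + x" by transfer (rule add.commute)
  show "0 + x = x" by transfer (rule add_0)
  show "- x + x = 0" by transfer (rule add.left_inverse)
  show "x - y = x + - y" by transfer (rule diff_conv_add_uminus)
  show "c *\<^sub>C (x + y) = c *\<^sub>C x + c *\<^sub>C y" by transfer (rule cscale_add_right)
  show "(c + d) *\<^sub>C x = c *\<^sub>C x + d *\<^sub>C x" by transfer (rule cscale_add_left)
  show "c *\<^sub>C d *\<^sub>C x = (c * d) *\<^sub>C x" by transfer (rule cscale_cscale)
  show "1 *\<^sub>C x = x" by transfer (rule cscale_one)
  show "bracket (x + y) z = bracket x z + bracket y z" by transfer (rule bracket_add_left)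
  show "bracket x (y + z) = bracket x y + bracket x z" by transfer (rule bracket_add_right)
  show "bracket (c *\<^sub>C x) y = c *\<^sub>C bracket x y" by transfer (rule bracket_cscale_left)
  show "bracket x (c *\<^sub>C y) = c *\<^sub>C bracket x y" by transfer (rule bracket_cscale_right)
  show "bracket x x = 0" by transfer (rule bracket_self)
  show "bracket x (bracket y z) + bracket y (bracket z x) + bracket z (bracket x y) = 0"
    by transfer (rule jacobi)
qed
end

section \<open>Whittaker modules\<close>

text \<open>\<open>U(sv)\<close> is a right \<open>U(sv\<^sup>+)\<close>-module through the algebra homomorphism induced by the inclusion
  of \<open>sv\<^sup>+\<close>; the left \<open>U(sv\<^sup>+)\<close>-module structure on the complex numbers extends the action of
  \<open>sv\<^sup>+\<close> through \<open>\<psi>\<close>.\<close>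

definition U_plus_ract :: "sv uea \<Rightarrow> sv_plus uea \<Rightarrow> sv uea" where
  "U_plus_ract u a = u * uea_lift (\<lambda>x. uea_of (sv_plus_incl x)) a"

definition C_psi_lact :: "(sv_plus \<Rightarrow> complex) \<Rightarrow> sv_plus uea \<Rightarrow> complex \<Rightarrow> complex" where
  "C_psi_lact \<psi> a \<alpha> = uea_lift \<psi> a * \<alpha>"

lemma lie_hom_sv_plus_incl: "lie_hom (\<lambda>x. uea_of (sv_plus_incl x))"
proof -
  have "uea_of (x + y) = uea_of x + uea_of y" "uea_of (c *\<^sub>C x) = c *\<^sub>C uea_of x"
    "uea_of (bracket x y) = uea_of x * uea_of y - uea_of y * uea_of x" for x y :: sv and c
    using lie_hom_uea_of[where 'a = sv] unfolding lie_hom_def linear_cscale_iff by blast+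
  then show ?thesis
    unfolding lie_hom_def linear_cscale_iff plus_sv_plus.rep_eq cscale_sv_plus.rep_eq
      bracket_sv_plus.rep_eq by blast
qed

type_synonym whittaker_vec = "(sv uea \<times> complex \<Rightarrow>\<^sub>0 int) set"

definition whittaker_module :: "(sv_plus \<Rightarrow> complex) \<Rightarrow> whittaker_vec set" where
  "whittaker_module \<psi> = tensor_space U_plus_ract (C_psi_lact \<psi>)"

definition whittaker_gen :: "(sv_plus \<Rightarrow> complex) \<Rightarrow> whittaker_vec" where
  "whittaker_gen \<psi> = pure_tensor U_plus_ract (C_psi_lact \<psi>) 1 1"

definition whittaker_act :: "(sv_plus \<Rightarrow> complex) \<Rightarrow> sv uea \<Rightarrow> whittaker_vec \<Rightarrow> whittaker_vec" where
  "whittaker_act \<psi> u = tensor_map U_plus_ract (C_psi_lact \<psi>) (\<lambda>u'. u * u')"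

definition whittaker_scale :: "(sv_plus \<Rightarrow> complex) \<Rightarrow> complex \<Rightarrow> whittaker_vec \<Rightarrow> whittaker_vec" where
  "whittaker_scale \<psi> c = tensor_map U_plus_ract (C_psi_lact \<psi>) (cscale c)"

definition is_whittaker_vector :: "(sv_plus \<Rightarrow> complex) \<Rightarrow> whittaker_vec \<Rightarrow> bool" where
  "is_whittaker_vector \<psi> v \<longleftrightarrow> v \<in> whittaker_module \<psi> \<and>
     (\<forall>x. whittaker_act \<psi> (uea_of (sv_plus_incl x)) v = whittaker_scale \<psi> (\<psi> x) v)"

definition M0_polys :: "sv uea set" where
  "M0_polys = is_subalgebra hull {uea_of (sv_M 0)}"

lemma whittaker_act_pure_tensor:
  "whittaker_act \<psi> u (pure_tensor U_plus_ract (C_psi_lact \<psi>) u' c) =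
     pure_tensor U_plus_ract (C_psi_lact \<psi>) (u * u') c"
proof -
  have "u * U_plus_ract m r = U_plus_ract (u * m) r" for m r
    by (simp only: U_plus_ract_def mult.assoc)
  from tensor_map_class[where ract = U_plus_ract and lact = "C_psi_lact \<psi>"
      and h = "\<lambda>u'. u * u'", OF distrib_left this] show ?thesis
    by (simp add: whittaker_act_def pure_tensor_def)
qed

lemma whittaker_scale_pure_tensor:
  "whittaker_scale \<psi> z (pure_tensor U_plus_ract (C_psi_lact \<psi>) u c) =
     pure_tensor U_plus_ract (C_psi_lact \<psi>) (z *\<^sub>C u) c"
proof -
  have "z *\<^sub>C U_plus_ract m r = U_plus_ract (z *\<^sub>C m) r" for m r
    by (simp only: U_plus_ract_def cscale_mult_left)
  from tensor_map_class[where ract = U_plus_ract and lact = "C_psi_lact \<psi>"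
      and h = "cscale z", OF cscale_add_right this] show ?thesis
    by (simp add: whittaker_scale_def pure_tensor_def)
qed

end

theory Submission
  imports Defs "HOL-Library.Multiset"
begin

text \<open>The vectors \<open>u w\<close> with \<open>u\<close> a polynomial in \<open>M\<^sub>0\<close> are Whittaker vectors because \<open>M\<^sub>0\<close> is
  central. For the converse, the Poincare-Birkhoff-Witt theorem says that the Whittaker module has a
  basis of monomials \<open>b\<^sub>1 \<cdots> b\<^sub>r w\<close> in the \<open>L\<^sub>n\<close> and \<open>M\<^sub>n\<close> with \<open>n \<le> 0\<close> and the \<open>Y\<close> with negative label.
  For \<open>x\<close> in \<open>sv\<^sup>+\<close> the operator \<open>x - \<psi>(x)\<close> acts on such a monomial almost as a derivation: \<open>x\<close> is moved
  to the right through the factors, and each factor \<open>b\<close> it meets is replaced by \<open>[x, b]\<close>.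

  Every admissible \<open>b\<close> except \<open>M\<^sub>0\<close> has a partner \<open>x\<close> in \<open>sv\<^sup>+\<close> such that \<open>[x, b]\<close> is a nonzero multiple
  of \<open>M\<^sub>1\<close>: if \<open>s\<close> is the label of \<open>b\<close>, the partner has label \<open>1 - s\<close> and is an \<open>M\<close>, a \<open>Y\<close> or an \<open>L\<close> according as
  \<open>b\<close> is an \<open>L\<close>, a \<open>Y\<close> or an \<open>M\<close>. If \<open>s\<close> is the lowest label that occurs, the other factors of the same type give
  multiples of some \<open>M\<^sub>m\<close> with \<open>m \<ge> 2\<close>. Up to terms with fewer factors \<open>L\<close>, the elements \<open>M\<^sub>m\<close> with
  \<open>m \<ge> 1\<close> act by the scalars \<open>\<psi>(M\<^sub>m)\<close>, which vanish for \<open>m \<ge> 2\<close>. So on the terms with the most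
  factors \<open>L\<close> the operator \<open>x - \<psi>(x)\<close> is a nonzero multiple of the partial derivative
  \<open>\<partial>/\<partial>b\<close>. A Whittaker vector is annihilated by it, hence \<open>b\<close> does not occur. This argument
  removes the \<open>L\<^sub>n\<close> (\<open>whittaker_support\<close>), then the \<open>Y\<close>, then the \<open>M\<^sub>n\<close> with \<open>n < 0\<close>; the order
  matters, because the partners of \<open>Y\<close> and \<open>M\<close> behave well only on monomials free of the types treated
  before. The general form is \<open>act_derivation\<close> together with \<open>leading_term_elimination\<close>.

  Linear independence of the monomials is obtained by constructing the induced module on the vector space
  freely spanned by multisets of indices, as in the classical proof of the Poincare-Birkhoff-Witt theorem
  (\<open>act_bracket\<close>). The resulting action of the enveloping algebra is compared with the tensor product in both
  directions: \<open>tens_eq_U_act\<close> maps the tensor product to the model, and \<open>tens_section\<close> recovers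
  a tensor from its image.\<close>

section \<open>Vector spaces with a distinguished basis\<close>

instantiation poly_mapping :: (type, complex_vs) complex_vs
begin
definition cscale_poly_mapping :: "complex \<Rightarrow> ('a \<Rightarrow>\<^sub>0 'b) \<Rightarrow> 'a \<Rightarrow>\<^sub>0 'b" where
  "cscale_poly_mapping c = Poly_Mapping.map (cscale c)"

lemma lookup_cscale: "Poly_Mapping.lookup (c *\<^sub>C p) a = c *\<^sub>C Poly_Mapping.lookup p a"
  for p :: "'a \<Rightarrow>\<^sub>0 'b"
  by (simp add: cscale_poly_mapping_def Poly_Mapping.map.rep_eq when_def)

instance
  by standard (rule poly_mapping_eqI,
    simp add: lookup_cscale lookup_add cscale_add_right cscale_add_left cscale_cscale cscale_one)+
end

abbreviation bvec :: "'a \<Rightarrow> 'a \<Rightarrow>\<^sub>0 complex" where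
  "bvec a \<equiv> Poly_Mapping.single a 1"

lemma cscale_complex: "c *\<^sub>C d = c * d" for c d :: complex
  by (simp add: cscale_complex_def)

lemma cscale_single: "c *\<^sub>C Poly_Mapping.single a d = Poly_Mapping.single a (c * d)" for d :: complex
  by (rule poly_mapping_eqI) (simp add: lookup_cscale lookup_single cscale_complex when_def)

lemma lin_ext_cscale: "lin_ext f (c *\<^sub>C p) = c *\<^sub>C lin_ext f p"
proof -
  have "Poly_Mapping.keys (c *\<^sub>C p) \<subseteq> Poly_Mapping.keys p"
    by (auto simp: in_keys_iff lookup_cscale)
  then show ?thesis
    by (simp add: lin_ext_superset[of "Poly_Mapping.keys p"] lookup_cscale cvs.scale_sum_right
        cscale_cscale cscale_complex)
qed

lemma lin_ext_cong:
  "(\<And>a. a \<in> Poly_Mapping.keys p \<Longrightarrow> f a = g a) \<Longrightarrow> lin_ext f p = lin_ext g p"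
  by (simp add: lin_ext_def)

lemma lin_ext_bvec_self: "lin_ext bvec p = p"
  by (induction p rule: poly_mapping_single_induct) (simp_all add: lin_ext_add cscale_single)

lemma lin_ext_zero_fun: "lin_ext (\<lambda>_. 0) p = 0"
  by (simp add: lin_ext_def)

lemma lin_ext_add_fun: "lin_ext (\<lambda>a. f a + g a) p = lin_ext f p + lin_ext g p"
  by (simp add: lin_ext_def cscale_add_right sum.distrib)

lemma lin_ext_diff_fun: "lin_ext (\<lambda>a. f a - g a) p = lin_ext f p - lin_ext g p"
  by (simp add: lin_ext_def cvs.scale_right_diff_distrib sum_subtractf)

lemma lin_ext_cscale_fun: "lin_ext (\<lambda>a. c *\<^sub>C f a) p = c *\<^sub>C lin_ext f p"
  by (simp add: lin_ext_def cvs.scale_sum_right cscale_cscale mult.commute)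

lemma linear_lin_ext:
  assumes "\<And>x y. F (x + y) = F x + F y" "\<And>c x. F (c *\<^sub>C x) = c *\<^sub>C F x"
  shows "F (lin_ext f p) = lin_ext (\<lambda>a. F (f a)) p"
proof (induction p rule: poly_mapping_single_induct)
  case zero
  have "F (0 *\<^sub>C 0) = 0 *\<^sub>C F 0" by (rule assms(2))
  then show ?case by simp
qed (simp_all add: lin_ext_add assms)

lemma keys_add_subset:
  "Poly_Mapping.keys p \<subseteq> A \<Longrightarrow> Poly_Mapping.keys q \<subseteq> A \<Longrightarrow> Poly_Mapping.keys (p + q) \<subseteq> A"
  using keys_add[of p q] by blast

lemma keys_cscale_subset:
  "Poly_Mapping.keys p \<subseteq> A \<Longrightarrow> Poly_Mapping.keys (c *\<^sub>C p) \<subseteq> A"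
  by (auto simp: in_keys_iff lookup_cscale)

lemma keys_lin_ext_subset:
  assumes "\<And>a. a \<in> Poly_Mapping.keys p \<Longrightarrow> Poly_Mapping.keys (f a) \<subseteq> A"
  shows "Poly_Mapping.keys (lin_ext f p) \<subseteq> A"
proof -
  have "Poly_Mapping.keys (\<Sum>a\<in>S. Poly_Mapping.lookup p a *\<^sub>C f a) \<subseteq> A"
    if "finite S" "S \<subseteq> Poly_Mapping.keys p" for S
    using that
  proof (induction S)
    case (insert a S)
    then show ?case by (simp add: keys_add_subset keys_cscale_subset assms)
  qed simp
  then show ?thesis by (simp add: lin_ext_def)
qed

section \<open>The module induced from a character\<close>

abbreviation weight :: "('i \<Rightarrow> nat) \<Rightarrow> 'i multiset \<Rightarrow> nat" where
  "weight \<omega> M \<equiv> sum_mset (image_mset \<omega> M)"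

text \<open>The Lie algebra has the basis \<open>basis\<close>, indexed by a linear order in which the indices of a
  subalgebra form the upper part \<open>P\<close>, and \<open>\<chi>\<close> gives the values on the basis of a character of that subalgebra.
  The aim is a model of the module induced from this character on the space spanned by the multisets
  of indices outside \<open>P\<close>; such a multiset stands for the ordered product of its members applied to the
  cyclic vector.\<close>

locale induced_module =
  fixes basis :: "'i::linorder \<Rightarrow> 'l::complex_lie_algebra"
    and coords :: "'l \<Rightarrow> 'i \<Rightarrow>\<^sub>0 complex"
    and P :: "'i set" and \<chi> :: "'i \<Rightarrow> complex"
  assumes coords_add: "coords (x + y) = coords x + coords y"
    and coords_cscale: "coords (c *\<^sub>C x) = c *\<^sub>C coords x"
    and coords_basis: "coords (basis i) = bvec i"
    and basis_coords: "lin_ext basis (coords x) = x"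
    and P_upper: "i \<notin> P \<Longrightarrow> j \<in> P \<Longrightarrow> i < j"
    and P_closed: "i \<in> P \<Longrightarrow> j \<in> P \<Longrightarrow> Poly_Mapping.keys (coords (bracket (basis i) (basis j))) \<subseteq> P"
    and \<chi>_bracket: "i \<in> P \<Longrightarrow> j \<in> P \<Longrightarrow> lin_ext \<chi> (coords (bracket (basis i) (basis j))) = 0"
begin

abbreviation br :: "'i \<Rightarrow> 'i \<Rightarrow> 'i \<Rightarrow>\<^sub>0 complex" where
  "br i j \<equiv> coords (bracket (basis i) (basis j))"

definition monomial :: "'i multiset \<Rightarrow> bool" where
  "monomial M \<longleftrightarrow> set_mset M \<inter> P = {}"

text \<open>The part of the action that merely inserts a factor. Elements of the subalgebra have none, because
  they are absorbed by the cyclic vector.\<close>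

definition lead :: "'i \<Rightarrow> 'i multiset \<Rightarrow> 'i multiset \<Rightarrow>\<^sub>0 complex" where
  "lead i M = (if i \<in> P then 0 else bvec (add_mset i M))"

text \<open>For such a weight the filtration of the enveloping algebra by the total weight of the factors is
  multiplicative, so straightening a product never increases the weight.\<close>

definition subadditive :: "('i \<Rightarrow> nat) \<Rightarrow> bool" where
  "subadditive \<omega> \<longleftrightarrow> (\<forall>i j. \<forall>k\<in>Poly_Mapping.keys (br i j). \<omega> k \<le> \<omega> i + \<omega> j)"

text \<open>If \<open>i\<close> exceeds the least member \<open>j\<close> of \<open>M = N + {j}\<close>, then \<open>i j N = j (i N) + [i, j] N\<close> is forced. The product
  \<open>j (i N)\<close> would involve multisets as large as \<open>M\<close> itself, but only through \<open>lead i N\<close>, and there \<open>j\<close> acts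
  by insertion since it is least; this contribution is the summand \<open>lead i M\<close>. All remaining calls concern
  multisets of size at most that of \<open>N\<close>. The numeral argument makes the recursion primitive; it bounds the sizes
  for which the value is meaningful. The action on multisets meeting \<open>P\<close> is set to zero, so that the
  bracket relation holds on them trivially.\<close>

primrec act_trunc :: "nat \<Rightarrow> 'i \<Rightarrow> 'i multiset \<Rightarrow> 'i multiset \<Rightarrow>\<^sub>0 complex" where
  "act_trunc 0 i M = 0"
| "act_trunc (Suc n) i M =
     (if \<not> monomial M then 0
      else if M = {#} then (if i \<in> P then Poly_Mapping.single {#} (\<chi> i) else lead i M)
      else if i \<le> Min (set_mset M) then lead i M
      else let j = Min (set_mset M); N = M - {#j#} in
        lead i M + lin_ext (act_trunc n j) (act_trunc n i N - lead i N)
                 + lin_ext (\<lambda>k. act_trunc n k N) (br i j))"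

lemma monomial_add_mset: "monomial (add_mset i M) \<longleftrightarrow> i \<notin> P \<and> monomial M"
  by (auto simp: monomial_def)

lemma monomial_empty: "monomial {#}"
  by (simp add: monomial_def)

lemma monomial_cases:
  assumes "monomial M"
  obtains (empty) "M = {#}"
  | (add) j N where "M = add_mset j N" "j \<notin> P" "monomial N" "\<forall>k\<in>#N. j \<le> k"
      "Min (set_mset M) = j" "M - {#j#} = N"
proof (cases "M = {#}")
  case False
  define j N where "j = Min (set_mset M)" and "N = M - {#j#}"
  have "j \<in># M" using False by (simp add: j_def)
  then have M: "M = add_mset j N" by (simp add: N_def)
  have "\<forall>k\<in>#N. j \<le> k" unfolding j_def N_def by (auto dest: in_diffD)
  moreover have "j \<notin> P" "monomial N" using assms M by (simp_all add: monomial_add_mset)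
  ultimately show thesis
    using that(2)[OF M _ _ _ j_def[symmetric] N_def[symmetric]] by blast
qed (use that in blast)

lemma act_trunc_add_mset:
  assumes "monomial (add_mset j N)" "\<forall>k\<in>#N. j \<le> k" "j < i"
  shows "act_trunc (Suc n) i (add_mset j N) =
    lead i (add_mset j N) + lin_ext (act_trunc n j) (act_trunc n i N - lead i N)
      + lin_ext (\<lambda>k. act_trunc n k N) (br i j)"
proof -
  have "Min (insert j (set_mset N)) = j" using assms(2) by (intro Min_eqI) auto
  moreover have "\<not> i \<le> j" using assms(3) by simp
  ultimately show ?thesis using assms(1) by (simp add: Let_def)
qed

text \<open>The bound on \<open>size\<close> is what makes the recursion legitimate; the bound on an arbitrary subadditive weight is
  obtained by the same induction.\<close>

lemma keys_act_trunc:
  assumes "subadditive \<omega>" "size M < n"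
  shows "Poly_Mapping.keys (act_trunc n i M - (if monomial M then lead i M else 0))
    \<subseteq> {N. size N \<le> size M \<and> monomial N \<and> weight \<omega> N \<le> \<omega> i + weight \<omega> M}"
  using assms(2)
proof (induction n arbitrary: i M)
  case (Suc n)
  show ?case
  proof (cases "monomial M")
    case True
    then show ?thesis
    proof (cases M rule: monomial_cases)
      case empty
      then show ?thesis by (simp add: monomial_empty lead_def)
    next
      case (add j N)
      let ?A = "{K. size K \<le> size M \<and> monomial K \<and> weight \<omega> K \<le> \<omega> i + weight \<omega> M}"
      show ?thesis
      proof (cases "i \<le> j")
        case True
        then show ?thesis using add \<open>monomial M\<close> by simp
      next
        case False
        then have "j < i" by simp
        from Suc.prems add(1) have size: "size N < n" by simp
        have nonlead: "Poly_Mapping.keys (act_trunc n k N - lead k N)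
          \<subseteq> {K. size K \<le> size N \<and> monomial K \<and> weight \<omega> K \<le> \<omega> k + weight \<omega> N}" for k
          using Suc.IH[OF size, of k] add(3) by simp
        have full: "Poly_Mapping.keys (act_trunc n k K)
          \<subseteq> {K'. size K' \<le> Suc (size K) \<and> monomial K' \<and> weight \<omega> K' \<le> \<omega> k + weight \<omega> K}"
          if "size K < n" "monomial K" for k K
        proof -
          have "Poly_Mapping.keys ((act_trunc n k K - lead k K) + lead k K)
            \<subseteq> {K'. size K' \<le> Suc (size K) \<and> monomial K' \<and> weight \<omega> K' \<le> \<omega> k + weight \<omega> K}"
            using Suc.IH[OF that(1), of k] that(2)
            by (intro keys_add_subset) (auto simp: lead_def monomial_add_mset)
          then show ?thesis by simp
        qed
        have "Poly_Mapping.keys (lin_ext (act_trunc n j) (act_trunc n i N - lead i N)) \<subseteq> ?A"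
        proof (rule keys_lin_ext_subset)
          fix K assume "K \<in> Poly_Mapping.keys (act_trunc n i N - lead i N)"
          with nonlead have "size K \<le> size N" "monomial K" "weight \<omega> K \<le> \<omega> i + weight \<omega> N" by blast+
          with full[of K j] size add(1) show "Poly_Mapping.keys (act_trunc n j K) \<subseteq> ?A" by fastforce
        qed
        moreover have "Poly_Mapping.keys (lin_ext (\<lambda>k. act_trunc n k N) (br i j)) \<subseteq> ?A"
        proof (rule keys_lin_ext_subset)
          fix k assume "k \<in> Poly_Mapping.keys (br i j)"
          with assms(1) have "\<omega> k \<le> \<omega> i + \<omega> j" by (auto simp: subadditive_def)
          with full[OF size add(3), of k] add(1) show "Poly_Mapping.keys (act_trunc n k N) \<subseteq> ?A" by fastforce
        qed
        ultimately show ?thesis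
          using act_trunc_add_mset[of j N i n] add \<open>monomial M\<close> \<open>j < i\<close>
          by (simp add: keys_add_subset del: act_trunc.simps)
      qed
    qed
  qed simp
qed simp

lemma subadditive_zero: "subadditive (\<lambda>_. 0)"
  by (simp add: subadditive_def)

lemma act_trunc_stable:
  assumes "size M < n" "size M < m"
  shows "act_trunc n i M = act_trunc m i M"
  using assms
proof (induction n arbitrary: m i M)
  case (Suc n)
  then obtain m' where m: "m = Suc m'" by (cases m) auto
  show ?case
  proof (cases "monomial M")
    case True
    then show ?thesis
    proof (cases M rule: monomial_cases)
      case empty
      then show ?thesis by (simp add: m)
    next
      case (add j N)
      have IH: "act_trunc n k K = act_trunc m' k K" if "size K \<le> size N" for k K
        using that Suc.prems Suc.IH[of K m' k] add(1) m by simp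
      show ?thesis
      proof (cases "i \<le> j")
        case True
        with add m show ?thesis by simp
      next
        case False
        have "lin_ext (act_trunc n j) (act_trunc m' i N - lead i N) =
          lin_ext (act_trunc m' j) (act_trunc m' i N - lead i N)"
        proof (rule lin_ext_cong, rule IH)
          fix K assume "K \<in> Poly_Mapping.keys (act_trunc m' i N - lead i N)"
          with keys_act_trunc[OF subadditive_zero, of N m' i] add Suc.prems m show "size K \<le> size N"
            by auto
        qed
        then show ?thesis
          using act_trunc_add_mset[of j N i n] act_trunc_add_mset[of j N i m'] add False True
          by (simp add: m IH not_le del: act_trunc.simps)
      qed
    qed
  qed (simp add: m)
qed simp

definition act_mono :: "'i \<Rightarrow> 'i multiset \<Rightarrow> 'i multiset \<Rightarrow>\<^sub>0 complex" where
  "act_mono i M = act_trunc (Suc (size M)) i M"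

definition act :: "'l \<Rightarrow> ('i multiset \<Rightarrow>\<^sub>0 complex) \<Rightarrow> 'i multiset \<Rightarrow>\<^sub>0 complex" where
  "act x q = lin_ext (\<lambda>i. lin_ext (act_mono i) q) (coords x)"

lemma act_add_left: "act (x + y) q = act x q + act y q"
  by (simp add: act_def coords_add lin_ext_add)

lemma act_cscale_left: "act (c *\<^sub>C x) q = c *\<^sub>C act x q"
  by (simp add: act_def coords_cscale lin_ext_cscale)

lemma act_add_right: "act x (p + q) = act x p + act x q"
  by (simp add: act_def lin_ext_add lin_ext_add_fun)

lemma act_cscale_right: "act x (c *\<^sub>C q) = c *\<^sub>C act x q"
  by (simp add: act_def lin_ext_cscale lin_ext_cscale_fun)

lemma act_zero [simp]: "act 0 q = 0" "act x 0 = 0"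
  using act_cscale_left[of 0 0 q] act_cscale_right[of x 0 0] by simp_all

lemma act_uminus_left: "act (- x) q = - act x q"
  using act_cscale_left[of "- 1" x q] by simp

lemma act_lin_ext_right: "act x (lin_ext f p) = lin_ext (\<lambda>a. act x (f a)) p"
  by (rule linear_lin_ext) (simp_all add: act_add_right act_cscale_right)

lemma act_lin_ext_left: "act (lin_ext f p) q = lin_ext (\<lambda>a. act (f a) q) p"
  by (rule linear_lin_ext[of "\<lambda>x. act x q"]) (simp_all add: act_add_left act_cscale_left)

lemma act_basis_bvec: "act (basis i) (bvec M) = act_mono i M"
  by (simp add: act_def coords_basis cscale_one)

lemma act_not_monomial:
  assumes "\<not> monomial M"
  shows "act x (bvec M) = 0"
  using assms by (simp add: act_def act_mono_def cscale_one lin_ext_zero_fun)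

lemma act_lead:
  assumes "i \<notin> P" "monomial M" "\<forall>k\<in>#M. i \<le> k"
  shows "act (basis i) (bvec M) = bvec (add_mset i M)"
  using assms by (auto simp: act_basis_bvec act_mono_def lead_def)

lemma act_character:
  assumes "i \<in> P"
  shows "act (basis i) (bvec {#}) = \<chi> i *\<^sub>C bvec {#}"
  using assms by (simp add: act_basis_bvec act_mono_def monomial_empty cscale_single del: single_one)

lemma keys_act_lead:
  assumes "subadditive \<omega>"
  shows "Poly_Mapping.keys (act (basis i) (bvec M) - (if monomial M then lead i M else 0))
    \<subseteq> {N. size N \<le> size M \<and> monomial N \<and> weight \<omega> N \<le> \<omega> i + weight \<omega> M}"
  using keys_act_trunc[OF assms, of M "Suc (size M)" i] by (simp add: act_basis_bvec act_mono_def)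

text \<open>The recursion without truncation: the two terms involving \<open>lead\<close> cancel.\<close>

lemma act_commute:
  assumes "j \<notin> P" "monomial N" "\<forall>k\<in>#N. j \<le> k" "j < i"
  shows "act (basis i) (bvec (add_mset j N)) =
    act (basis j) (act (basis i) (bvec N)) + act (bracket (basis i) (basis j)) (bvec N)"
proof -
  let ?n = "Suc (size N)"
  have mono: "monomial (add_mset j N)" using assms by (simp add: monomial_add_mset)
  have trunc: "act_trunc ?n k K = act_mono k K" if "size K \<le> size N" for k K
    using that act_trunc_stable[of K ?n "Suc (size K)" k] by (simp add: act_mono_def del: act_trunc.simps)
  have "act_mono i (add_mset j N) = lead i (add_mset j N)
      + lin_ext (act_trunc ?n j) (act_mono i N - lead i N) + lin_ext (\<lambda>k. act_mono k N) (br i j)"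
    using act_trunc_add_mset[OF mono assms(3,4), of ?n]
    by (simp add: act_mono_def[of i "add_mset j N"] trunc del: act_trunc.simps)
  also have "lin_ext (act_trunc ?n j) (act_mono i N - lead i N) = lin_ext (act_mono j) (act_mono i N - lead i N)"
  proof (rule lin_ext_cong, rule trunc)
    fix K assume "K \<in> Poly_Mapping.keys (act_mono i N - lead i N)"
    with keys_act_lead[OF subadditive_zero, of i N] assms(2) show "size K \<le> size N"
      by (auto simp: act_basis_bvec)
  qed
  also have "\<dots> = act (basis j) (act (basis i) (bvec N)) - act (basis j) (lead i N)"
    by (simp add: act_basis_bvec act_def coords_basis cscale_one lin_ext_diff)
  also have "lin_ext (\<lambda>k. act_mono k N) (br i j) = act (bracket (basis i) (basis j)) (bvec N)"
    by (simp add: act_def cscale_one)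
  also have "act (basis j) (lead i N) = lead i (add_mset j N)"
    using assms act_lead[of j "add_mset i N"]
    by (auto simp: lead_def monomial_add_mset add_mset_commute)
  finally show ?thesis by (simp add: act_basis_bvec)
qed

end

section \<open>The bracket relation in the induced module\<close>

lemma bracket_antisym: "bracket y x = - bracket x y" for x y :: "'a::complex_lie_algebra"
proof -
  have "bracket y x + bracket x y = bracket (x + y) (x + y)"
    by (simp only: bracket_add_left bracket_add_right) (simp add: bracket_self)
  then show ?thesis by (simp only: bracket_self eq_neg_iff_add_eq_0)
qed

lemma bracket_uminus_right: "bracket x (- y) = - bracket x y" for x y :: "'a::complex_lie_algebra"
  using bracket_cscale_right[of x "- 1" y] by simp

context induced_module
begin

lemma basis_induct [case_names add scale basis]:
  assumes "\<And>x y. Q x \<Longrightarrow> Q y \<Longrightarrow> Q (x + y)" "\<And>c x. Q x \<Longrightarrow> Q (c *\<^sub>C x)" "\<And>i. Q (basis i)"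
  shows "Q x"
proof -
  have "Q (lin_ext basis p)" for p
  proof (induction p rule: poly_mapping_single_induct)
    case zero
    then show ?case using assms(2)[OF assms(3), of 0] by simp
  qed (simp_all add: lin_ext_add assms)
  from this[of "coords x"] show ?thesis by (simp add: basis_coords)
qed

definition bracket_compatible :: "'l \<Rightarrow> 'l \<Rightarrow> ('i multiset \<Rightarrow>\<^sub>0 complex) \<Rightarrow> bool" where
  "bracket_compatible x y q \<longleftrightarrow> act x (act y q) = act y (act x q) + act (bracket x y) q"

lemma bracket_compatible_extend:
  assumes "\<And>K i j. K \<in> Poly_Mapping.keys q \<Longrightarrow> bracket_compatible (basis i) (basis j) (bvec K)"
  shows "bracket_compatible x y q"
proof -
  note lin = act_add_left act_add_right act_cscale_left act_cscale_right
    bracket_add_left bracket_add_right bracket_cscale_left bracket_cscale_right cscale_add_right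
  have K: "bracket_compatible x y (bvec K)" if "K \<in> Poly_Mapping.keys q" for K
  proof (induction x rule: basis_induct)
    case (basis i)
    show ?case
    proof (induction y rule: basis_induct)
      case (basis j)
      show ?case using assms that by blast
    qed (simp_all add: bracket_compatible_def lin add_ac)
  qed (simp_all add: bracket_compatible_def lin add_ac)
  have "act x (act y (lin_ext bvec q)) = act y (act x (lin_ext bvec q)) + act (bracket x y) (lin_ext bvec q)"
    unfolding act_lin_ext_right lin_ext_add_fun[symmetric]
    by (rule lin_ext_cong) (use K in \<open>simp add: bracket_compatible_def\<close>)
  then show ?thesis by (simp add: bracket_compatible_def lin_ext_bvec_self)
qed

lemma bracket_compatible_sym: "bracket_compatible x y q \<longleftrightarrow> bracket_compatible y x q"
  using bracket_antisym[of y x] by (auto simp: bracket_compatible_def act_uminus_left)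

text \<open>The classical argument for the Poincare-Birkhoff-Witt theorem, by induction on the size of \<open>N\<close>. By antisymmetry let
  \<open>j < i\<close>. If \<open>j\<close> may be inserted in front of \<open>N\<close>, the relation is the recursion. If \<open>N\<close> is empty, both
  indices lie in \<open>P\<close> and the character kills their bracket. Otherwise \<open>N = Q + {k}\<close> with \<open>k\<close> less than \<open>i\<close> and
  \<open>j\<close>; both sides are expanded by moving \<open>k\<close> to the front, and the Jacobi identity closes the gap.\<close>

lemma bracket_compatible_bvec: "bracket_compatible (basis i) (basis j) (bvec N)"
proof (induction N arbitrary: i j rule: measure_induct_rule[of size])
  case (less N)
  have step: "bracket_compatible (basis i) (basis j) (bvec N)" if "monomial N" "j < i" for i j
  proof (cases "j \<notin> P \<and> (\<forall>k\<in>#N. j \<le> k)")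
    case True
    then show ?thesis
      using act_commute[of j N i] act_lead[of j N] that by (simp add: bracket_compatible_def)
  next
    case nonlead: False
    show ?thesis
      using that(1)
    proof (cases N rule: monomial_cases)
      case empty
      then have "j \<in> P" using nonlead by simp
      then have "i \<in> P" using P_upper[of i j] that(2) by fastforce
      have "act (bracket (basis i) (basis j)) (bvec {#}) =
        lin_ext (\<lambda>k. act (basis k) (bvec {#})) (br i j)"
        by (subst basis_coords[of "bracket (basis i) (basis j)", symmetric]) (rule act_lin_ext_left)
      also have "\<dots> = lin_ext (\<lambda>k. \<chi> k *\<^sub>C bvec {#}) (br i j)"
        using P_closed[OF \<open>i \<in> P\<close> \<open>j \<in> P\<close>] by (intro lin_ext_cong act_character) blast
      also have "\<dots> = lin_ext \<chi> (br i j) *\<^sub>C bvec {#}"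
        by (simp add: lin_ext_def cvs.scale_sum_left cscale_cscale cscale_complex del: single_one)
      also have "\<dots> = 0" using \<chi>_bracket[OF \<open>i \<in> P\<close> \<open>j \<in> P\<close>] by simp
      finally show ?thesis
        using \<open>i \<in> P\<close> \<open>j \<in> P\<close> empty
        by (simp add: bracket_compatible_def act_character act_cscale_right cscale_cscale mult.commute
            del: single_one)
    next
      case (add k Q)
      have "k < j"
        using nonlead add P_upper[of k j] by (cases "j \<in> P") (auto simp: not_le intro: order.strict_trans1)
      have IH: "bracket_compatible x y q" if "\<And>K. K \<in> Poly_Mapping.keys q \<Longrightarrow> size K < size N" for x y q
        by (rule bracket_compatible_extend) (rule less.IH, rule that)
      have Q: "bracket_compatible x y (bvec Q)" for x y
        using add(1) by (intro IH) simp
      have N: "bvec N = act (basis k) (bvec Q)"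
        using act_lead[of k Q] add by simp
      \<comment> \<open>Here the leading part of \<open>c Q\<close> is as large as \<open>N\<close>, beyond the induction hypothesis; but \<open>k\<close> is
          still least in it, so the recursion applies instead.\<close>
      have past: "act (basis a) (act (basis k) (act (basis c) (bvec Q))) =
          act (basis k) (act (basis a) (act (basis c) (bvec Q)))
            + act (bracket (basis a) (basis k)) (act (basis c) (bvec Q))"
        if "k < a" "k < c" for a c
      proof -
        define w where "w = act (basis c) (bvec Q) - lead c Q"
        have w: "act (basis c) (bvec Q) = lead c Q + w" by (simp add: w_def)
        have "bracket_compatible (basis a) (basis k) w"
        proof (rule IH)
          fix K assume "K \<in> Poly_Mapping.keys w"
          with keys_act_lead[OF subadditive_zero, of c Q] add show "size K < size N"
            by (auto simp: w_def)
        qed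
        moreover have "bracket_compatible (basis a) (basis k) (lead c Q)"
        proof (cases "c \<in> P")
          case False
          then have "act (basis a) (bvec (add_mset k (add_mset c Q))) =
            act (basis k) (act (basis a) (bvec (add_mset c Q)))
              + act (bracket (basis a) (basis k)) (bvec (add_mset c Q))"
            using add that by (intro act_commute) (auto simp: monomial_add_mset)
          moreover have "act (basis k) (bvec (add_mset c Q)) = bvec (add_mset k (add_mset c Q))"
            using add that False by (intro act_lead) (auto simp: monomial_add_mset)
          ultimately show ?thesis using False by (simp add: lead_def bracket_compatible_def)
        qed (simp add: lead_def bracket_compatible_def)
        ultimately show ?thesis
          by (simp add: w bracket_compatible_def act_add_right add_ac)
      qed
      have expand: "act (basis a) (act (basis c) (bvec N)) =
          act (basis k) (act (basis a) (act (basis c) (bvec Q)))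
            + act (bracket (basis a) (basis k)) (act (basis c) (bvec Q))
            + act (bracket (basis c) (basis k)) (act (basis a) (bvec Q))
            + act (bracket (basis a) (bracket (basis c) (basis k))) (bvec Q)"
        if "k < a" "k < c" for a c
        using past[OF that] Q[of "basis c" "basis k"] Q[of "basis a" "bracket (basis c) (basis k)"]
        by (simp add: N bracket_compatible_def act_add_right add_ac)
      have "k < i" using \<open>k < j\<close> that(2) by simp
      have jac: "bracket (basis i) (bracket (basis j) (basis k))
          = bracket (basis j) (bracket (basis i) (basis k)) + bracket (bracket (basis i) (basis j)) (basis k)"
        using jacobi[of "basis i" "basis j" "basis k"] bracket_antisym[of "basis k" "basis i"]
          bracket_antisym[of "basis k" "bracket (basis i) (basis j)"]
        by (simp add: bracket_uminus_right algebra_simps)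
      have "act (basis i) (act (basis j) (bvec N)) - act (basis j) (act (basis i) (bvec N)) =
          act (basis k) (act (bracket (basis i) (basis j)) (bvec Q))
            + act (bracket (bracket (basis i) (basis j)) (basis k)) (bvec Q)"
        using Q[of "basis i" "basis j"] expand[OF \<open>k < i\<close> \<open>k < j\<close>] expand[OF \<open>k < j\<close> \<open>k < i\<close>]
        by (simp add: bracket_compatible_def jac act_add_left act_add_right)
      also have "\<dots> = act (bracket (basis i) (basis j)) (bvec N)"
        using Q[of "bracket (basis i) (basis j)" "basis k"] by (simp add: N bracket_compatible_def)
      finally show ?thesis by (simp add: bracket_compatible_def algebra_simps)
    qed
  qed
  show ?case
  proof (cases "monomial N")
    case True
    then show ?thesis
      using step[OF True, of j i] step[OF True, of i j] bracket_compatible_sym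
      by (cases i j rule: linorder_cases) (auto simp: bracket_compatible_def bracket_self)
  qed (simp add: bracket_compatible_def act_not_monomial)
qed

theorem act_bracket: "act (bracket x y) q = act x (act y q) - act y (act x q)"
proof -
  have "bracket_compatible x y q"
    by (rule bracket_compatible_extend) (rule bracket_compatible_bvec)
  then show ?thesis by (simp add: bracket_compatible_def)
qed

section \<open>Leading terms of the action\<close>

lemma keys_act:
  assumes "subadditive \<omega>"
  shows "Poly_Mapping.keys (act (basis i) (bvec M)) \<subseteq> {N. monomial N \<and> weight \<omega> N \<le> \<omega> i + weight \<omega> M}"
proof -
  let ?A = "{N. monomial N \<and> weight \<omega> N \<le> \<omega> i + weight \<omega> M}"
    and ?l = "if monomial M then lead i M else 0"
  have "Poly_Mapping.keys (act (basis i) (bvec M) - ?l) \<subseteq> ?A"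
    using keys_act_lead[OF assms, of i M] by blast
  moreover have "Poly_Mapping.keys ?l \<subseteq> ?A"
    by (auto simp: lead_def monomial_add_mset)
  ultimately have "Poly_Mapping.keys (act (basis i) (bvec M) - ?l + ?l) \<subseteq> ?A"
    by (rule keys_add_subset)
  then show ?thesis by (simp only: diff_add_cancel)
qed

lemma act_straighten:
  assumes "j \<notin> P" "monomial N" "\<forall>k\<in>#N. j \<le> k"
  shows "act (basis i) (bvec (add_mset j N)) =
    act (basis j) (act (basis i) (bvec N)) + act (bracket (basis i) (basis j)) (bvec N)"
  using act_lead[OF assms] act_bracket[of "basis i" "basis j" "bvec N"] by simp

lemma keys_act_subset:
  assumes "subadditive \<omega>" "Poly_Mapping.keys q \<subseteq> {N. weight \<omega> N + e \<le> n}"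
  shows "Poly_Mapping.keys (act (basis j) q) \<subseteq> {N. weight \<omega> N + e \<le> \<omega> j + n}"
proof -
  have "act (basis j) q = lin_ext (\<lambda>N. act (basis j) (bvec N)) q"
    using act_lin_ext_right[of "basis j" bvec q] by (simp add: lin_ext_bvec_self)
  moreover have "Poly_Mapping.keys (lin_ext (\<lambda>N. act (basis j) (bvec N)) q) \<subseteq> {N. weight \<omega> N + e \<le> \<omega> j + n}"
    using keys_act[OF assms(1), of j] assms(2) by (intro keys_lin_ext_subset) fastforce
  ultimately show ?thesis by simp
qed

text \<open>Moving \<open>i\<close> through the factors of \<open>M\<close> from the least one on produces, for every factor \<open>j\<close>, the bracket \<open>[i, j]\<close>
  acting on the remaining factors, and finally the scalar \<open>\<chi> i\<close>. If modulo terms of low weight these brackets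
  act by zero, except for \<open>j = b\<close>, then \<open>i - \<chi> i\<close> acts as \<open>\<kappa> \<partial>/\<partial>b\<close> modulo such terms. The factors passed
  are put back in front exactly, without correction, since they are removed in increasing order.\<close>

lemma act_derivation:
  assumes \<omega>: "subadditive \<omega>" and "i \<in> P" "monomial M"
    and pairing: "\<And>j N. j \<in># M \<Longrightarrow> N \<subseteq># M \<Longrightarrow>
      Poly_Mapping.keys (act (bracket (basis i) (basis j)) (bvec N) - (if j = b then \<kappa> else 0) *\<^sub>C bvec N)
        \<subseteq> {K. weight \<omega> K + e \<le> weight \<omega> N + \<omega> j}"
  shows "Poly_Mapping.keys (act (basis i) (bvec M) - \<chi> i *\<^sub>C bvec M
      - (\<kappa> * of_nat (count M b)) *\<^sub>C bvec (M - {#b#}))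
    \<subseteq> {K. weight \<omega> K + e \<le> weight \<omega> M}"
  using assms(3) pairing
proof (induction M rule: measure_induct_rule[of size])
  case (less M)
  from less.prems(1) show ?case
  proof (cases M rule: monomial_cases)
    case empty
    then show ?thesis using \<open>i \<in> P\<close> by (simp add: act_character del: single_one)
  next
    case (add j N)
    define r where "r = act (basis i) (bvec N) - \<chi> i *\<^sub>C bvec N
      - (\<kappa> * of_nat (count N b)) *\<^sub>C bvec (N - {#b#})"
    define s where "s = act (bracket (basis i) (basis j)) (bvec N) - (if j = b then \<kappa> else 0) *\<^sub>C bvec N"
    have r: "Poly_Mapping.keys r \<subseteq> {K. weight \<omega> K + e \<le> weight \<omega> N}"
      unfolding r_def
    proof (rule less.IH)
      fix k K assume "k \<in># N" "K \<subseteq># N"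
      moreover from this add(1) have "K \<subseteq># M" by (auto intro: subset_mset.order_trans)
      ultimately show "Poly_Mapping.keys (act (bracket (basis i) (basis k)) (bvec K) -
          (if k = b then \<kappa> else 0) *\<^sub>C bvec K) \<subseteq> {K'. weight \<omega> K' + e \<le> weight \<omega> K + \<omega> k}"
        using add(1) by (intro less.prems(2)) auto
    qed (use add in auto)
    have s: "Poly_Mapping.keys s \<subseteq> {K. weight \<omega> K + e \<le> weight \<omega> N + \<omega> j}"
      unfolding s_def using add by (intro less.prems(2)) auto
    have lead: "act (basis j) (bvec K) = bvec (add_mset j K)" if "K \<subseteq># N" for K
      using add that by (intro act_lead) (auto simp: monomial_def dest: mset_subset_eqD)
    have "act (basis i) (bvec N) = r + \<chi> i *\<^sub>C bvec N + (\<kappa> * of_nat (count N b)) *\<^sub>C bvec (N - {#b#})"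
      by (simp add: r_def)
    then have expand: "act (basis i) (bvec M) = act (basis j) r + \<chi> i *\<^sub>C bvec M
      + (\<kappa> * of_nat (count N b)) *\<^sub>C bvec (add_mset j (N - {#b#})) + (s + (if j = b then \<kappa> else 0) *\<^sub>C bvec N)"
      using act_straighten[of j N i] add lead
      by (simp add: act_add_right act_cscale_right s_def)
    have "(\<kappa> * of_nat (count N b)) *\<^sub>C bvec (add_mset j (N - {#b#})) + (s + (if j = b then \<kappa> else 0) *\<^sub>C bvec N)
      = s + (\<kappa> * of_nat (count M b)) *\<^sub>C bvec (M - {#b#})"
    proof (cases "b \<in># N")
      case True
      then show ?thesis using add(1) by (auto simp: cscale_add_left algebra_simps)
    next
      case False
      then show ?thesis using add(1) by (auto simp: not_in_iff)
    qed
    with expand have "act (basis i) (bvec M) - \<chi> i *\<^sub>C bvec M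
      - (\<kappa> * of_nat (count M b)) *\<^sub>C bvec (M - {#b#}) = act (basis j) r + s"
      by (simp add: add.assoc)
    moreover have "Poly_Mapping.keys (act (basis j) r + s) \<subseteq> {K. weight \<omega> K + e \<le> weight \<omega> M}"
      using keys_act_subset[OF \<omega> r, of j] s add(1) by (intro keys_add_subset) (auto simp: add_ac)
    ultimately show ?thesis by simp
  qed
qed

end

text \<open>If an operator is a nonzero multiple of \<open>\<partial>/\<partial>b\<close> on the terms of top weight, then a vector it annihilates has no
  term of top weight containing \<open>b\<close>. The derivative is only available for a \<open>b\<close> of maximal height among the
  elements of \<open>T\<close> that occur in the terms of top weight, so that \<open>b\<close> is chosen first; its occurrence in such a
  term \<open>K\<close> shows in the coefficient of \<open>K - {b}\<close>, to which no other term contributes.\<close>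

lemma leading_term_elimination:
  fixes p :: "'i multiset \<Rightarrow>\<^sub>0 complex" and D :: "'i \<Rightarrow> 'i multiset \<Rightarrow> 'i multiset \<Rightarrow>\<^sub>0 complex"
    and \<omega> height :: "'i \<Rightarrow> nat"
  assumes killed: "\<And>b. b \<in> T \<Longrightarrow> lin_ext (D b) p = 0"
    and \<kappa>: "\<And>b. b \<in> T \<Longrightarrow> \<kappa> b \<noteq> (0::complex)"
    and weightless: "\<And>M. M \<in> Poly_Mapping.keys p \<Longrightarrow> set_mset M \<inter> T = {} \<Longrightarrow> weight \<omega> M = 0"
    and bound: "\<And>b M. b \<in> T \<Longrightarrow> M \<in> Poly_Mapping.keys p \<Longrightarrow>
      Poly_Mapping.keys (D b M) \<subseteq> {N. weight \<omega> N + \<omega> b \<le> weight \<omega> M}"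
    and derivation: "\<And>b M. b \<in> T \<Longrightarrow> M \<in> Poly_Mapping.keys p \<Longrightarrow> (\<forall>j\<in>set_mset M \<inter> T. height j \<le> height b) \<Longrightarrow>
      Poly_Mapping.keys (D b M - (\<kappa> b * of_nat (count M b)) *\<^sub>C bvec (M - {#b#}))
        \<subseteq> {N. weight \<omega> N + \<omega> b < weight \<omega> M}"
    and M: "M \<in> Poly_Mapping.keys p"
  shows "set_mset M \<inter> T = {}"
proof (rule ccontr)
  assume "set_mset M \<inter> T \<noteq> {}"
  define B where "B = {M \<in> Poly_Mapping.keys p. set_mset M \<inter> T \<noteq> {}}"
  have B: "finite B" "B \<noteq> {}" using M \<open>set_mset M \<inter> T \<noteq> {}\<close> by (auto simp: B_def)
  define d where "d = Max (weight \<omega> ` B)"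
  have le_d: "weight \<omega> K \<le> d" if "K \<in> Poly_Mapping.keys p" for K
  proof (cases "K \<in> B")
    case True
    then show ?thesis unfolding d_def using B(1) by (intro Max_ge) auto
  next
    case False
    then have "weight \<omega> K = 0" using that by (intro weightless) (auto simp: B_def)
    then show ?thesis by (simp only: le0)
  qed
  define C where "C = (\<Union>K\<in>{K\<in>B. weight \<omega> K = d}. set_mset K \<inter> T)"
  have "d \<in> weight \<omega> ` B" unfolding d_def using B by (intro Max_in) auto
  then have C: "finite C" "C \<noteq> {}" using B by (auto simp: C_def B_def)
  have "Max (height ` C) \<in> height ` C" using C by (intro Max_in) auto
  then obtain b where "b \<in> C" and height_b: "height b = Max (height ` C)" by auto
  then have b: "height c \<le> height b" if "c \<in> C" for c
    using that C(1) by (simp add: height_b)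
  from \<open>b \<in> C\<close> obtain K where K: "K \<in> Poly_Mapping.keys p" "weight \<omega> K = d" "b \<in># K" and "b \<in> T"
    by (auto simp: C_def B_def)
  let ?N = "K - {#b#}"
  have wN: "weight \<omega> ?N + \<omega> b = d"
    using K by (metis (no_types, lifting) add.commute image_mset_add_mset insert_DiffM sum_mset.add_mset)
  have coeff: "Poly_Mapping.lookup (D b M) ?N = (\<kappa> b * of_nat (count M b) when M = K)"
    if "M \<in> Poly_Mapping.keys p" for M
  proof (cases "weight \<omega> M = d")
    case True
    have "\<forall>j\<in>set_mset M \<inter> T. height j \<le> height b"
      using b that True by (auto simp: C_def B_def)
    from derivation[OF \<open>b \<in> T\<close> that this] True wN
    have "?N \<notin> Poly_Mapping.keys (D b M - (\<kappa> b * of_nat (count M b)) *\<^sub>C bvec (M - {#b#}))" by auto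
    then have "Poly_Mapping.lookup (D b M) ?N = \<kappa> b * of_nat (count M b) * (1 when M - {#b#} = ?N)"
      by (simp add: in_keys_iff lookup_minus lookup_cscale lookup_single cscale_complex)
    moreover have "M - {#b#} = ?N \<longleftrightarrow> M = K" if "b \<in># M"
      using that K(3) by (metis insert_DiffM)
    ultimately show ?thesis by (cases "b \<in># M") (auto simp: when_def not_in_iff)
  next
    case False
    then have "?N \<notin> Poly_Mapping.keys (D b M)"
      using bound[OF \<open>b \<in> T\<close> that] le_d[OF that] wN by auto
    then show ?thesis using False K by (auto simp: in_keys_iff when_def)
  qed
  have "0 = Poly_Mapping.lookup (lin_ext (D b) p) ?N" by (simp add: killed \<open>b \<in> T\<close>)
  also have "\<dots> = (\<Sum>M\<in>Poly_Mapping.keys p. Poly_Mapping.lookup p M * Poly_Mapping.lookup (D b M) ?N)"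
    by (simp add: lin_ext_def lookup_sum lookup_cscale cscale_complex)
  also have "\<dots> = (\<Sum>M\<in>Poly_Mapping.keys p. if M = K then Poly_Mapping.lookup p K * (\<kappa> b * of_nat (count K b)) else 0)"
    by (rule sum.cong) (auto simp: coeff when_def)
  also have "\<dots> = Poly_Mapping.lookup p K * (\<kappa> b * of_nat (count K b))"
    using K(1) by simp
  finally have "count K b = 0" using K(1) \<kappa>[OF \<open>b \<in> T\<close>] by (simp add: in_keys_iff)
  then show False using K(3) by (simp add: count_eq_zero_iff)
qed

section \<open>The action of the enveloping algebra\<close>

text \<open>The endomorphism algebra of a vector space is the target through which the universal property of the
  enveloping algebra turns a representation into a module. Spaces with a nonempty basis are nonzero, which
  makes zero and one distinct.\<close>

typedef 'k endo = "{f :: ('k \<Rightarrow>\<^sub>0 complex) \<Rightarrow> ('k \<Rightarrow>\<^sub>0 complex). Vector_Spaces.linear cscale cscale f}"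
  morphisms endo_app Endo
  by (rule exI[of _ id]) (simp add: linear_cscale_iff)

setup_lifting type_definition_endo

instantiation endo :: (type) complex_algebra_1
begin
lift_definition zero_endo :: "'a endo" is "\<lambda>_. 0" by (simp add: linear_cscale_iff)
lift_definition one_endo :: "'a endo" is "\<lambda>q. q" by (simp add: linear_cscale_iff)
lift_definition plus_endo :: "'a endo \<Rightarrow> 'a endo \<Rightarrow> 'a endo" is "\<lambda>f g q. f q + g q"
  by (simp add: linear_cscale_iff cscale_add_right add_ac)
lift_definition minus_endo :: "'a endo \<Rightarrow> 'a endo \<Rightarrow> 'a endo" is "\<lambda>f g q. f q - g q"
  by (simp add: linear_cscale_iff cvs.scale_right_diff_distrib)
lift_definition uminus_endo :: "'a endo \<Rightarrow> 'a endo" is "\<lambda>f q. - f q"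
  by (simp add: linear_cscale_iff)
lift_definition times_endo :: "'a endo \<Rightarrow> 'a endo \<Rightarrow> 'a endo" is "\<lambda>f g q. f (g q)"
  by (simp add: linear_cscale_iff)
lift_definition cscale_endo :: "complex \<Rightarrow> 'a endo \<Rightarrow> 'a endo" is "\<lambda>c f q. c *\<^sub>C f q"
  by (simp add: linear_cscale_iff cscale_add_right cscale_cscale mult.commute)
instance
proof
  show "(0 :: 'a endo) \<noteq> 1"
  proof (transfer, rule notI)
    assume eq: "(\<lambda>_ :: 'a \<Rightarrow>\<^sub>0 complex. 0 :: 'a \<Rightarrow>\<^sub>0 complex) = (\<lambda>q. q)"
    have "Poly_Mapping.lookup (bvec (undefined :: 'a)) undefined = 0"
      by (subst fun_cong[OF eq, of "bvec undefined", symmetric]) simp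
    then show False by simp
  qed
qed (transfer, auto simp: fun_eq_iff linear_cscale_iff cscale_add_right cscale_add_left cscale_cscale)+
end

lemma abs_uea_word:
  "abs_uea (Poly_Mapping.single (Word xs) c) = c *\<^sub>C prod_list (map uea_of xs)"
proof (induction xs)
  case Nil
  have "Poly_Mapping.single (Word []) c = Poly_Mapping.single 0 c * (1 :: 'a free_alg)"
    by (simp add: zero_free_monoid_def)
  then show ?case by (simp add: cscale_uea.abs_eq one_uea.abs_eq)
next
  case (Cons x xs)
  have "Poly_Mapping.single (Word (x # xs)) c = gen x * Poly_Mapping.single (Word xs) c"
    by (simp add: gen_def mult_single plus_free_monoid_def)
  then show ?case
    by (simp add: Cons.IH uea_of.abs_eq cscale_mult_right flip: times_uea.abs_eq)
qed

lemma uea_induct [case_names one add scale mult]: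
  fixes u :: "'l::complex_lie_algebra uea"
  assumes "Q 1" "\<And>u v. Q u \<Longrightarrow> Q v \<Longrightarrow> Q (u + v)" "\<And>c u. Q u \<Longrightarrow> Q (c *\<^sub>C u)"
    and "\<And>x u. Q u \<Longrightarrow> Q (uea_of x * u)"
  shows "Q u"
proof (induction u rule: uea.abs_induct)
  case (1 p)
  show ?case
  proof (induction p rule: poly_mapping_single_induct)
    case zero
    have "Q (0 *\<^sub>C 1)" by (intro assms)
    then show ?case by (simp add: zero_uea_def)
  next
    case (add p q)
    then show ?case by (simp add: assms(2) flip: plus_uea.abs_eq)
  next
    case (single w c)
    have "Q (prod_list (map uea_of xs))" for xs
      by (induction xs) (simp_all add: assms)
    then show ?case by (cases w) (simp add: abs_uea_word assms(3))
  qed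
qed

lemma uea_of_add: "uea_of (x + y) = uea_of x + uea_of y"
  and uea_of_cscale: "uea_of (c *\<^sub>C x) = c *\<^sub>C uea_of x"
  and uea_of_bracket: "uea_of (bracket x y) = uea_of x * uea_of y - uea_of y * uea_of x"
  using lie_hom_uea_of[where 'a = 'a] unfolding lie_hom_def linear_cscale_iff by blast+

context induced_module
begin

lemma endo_app_Endo_act: "endo_app (Endo (act x)) = act x"
  by (rule Endo_inverse) (simp add: linear_cscale_iff act_add_right act_cscale_right)

lemma lie_hom_act: "lie_hom (\<lambda>x. Endo (act x))"
  unfolding lie_hom_def linear_cscale_iff
  by (auto simp: endo_app_inject[symmetric] plus_endo.rep_eq cscale_endo.rep_eq minus_endo.rep_eq
      times_endo.rep_eq endo_app_Endo_act fun_eq_iff act_add_left act_cscale_left act_bracket)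

definition U_act :: "'l uea \<Rightarrow> ('i multiset \<Rightarrow>\<^sub>0 complex) \<Rightarrow> 'i multiset \<Rightarrow>\<^sub>0 complex" where
  "U_act u = endo_app (uea_lift (\<lambda>x. Endo (act x)) u)"

lemma U_act_one: "U_act 1 q = q"
  and U_act_mult: "U_act (u * v) q = U_act u (U_act v q)"
  and U_act_add_left: "U_act (u + v) q = U_act u q + U_act v q"
  and U_act_cscale_left: "U_act (c *\<^sub>C u) q = c *\<^sub>C U_act u q"
  using alg_hom_uea_lift[OF lie_hom_act]
  by (simp_all add: alg_hom_def linear_cscale_iff U_act_def one_endo.rep_eq times_endo.rep_eq
      plus_endo.rep_eq cscale_endo.rep_eq)

lemma U_act_uea_of: "U_act (uea_of x) q = act x q"
  by (simp add: U_act_def uea_lift_uea_of lie_hom_act endo_app_Endo_act)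

lemma U_act_cscale_right: "U_act u (c *\<^sub>C q) = c *\<^sub>C U_act u q"
  using endo_app[of "uea_lift (\<lambda>x. Endo (act x)) u"] by (simp add: U_act_def linear_cscale_iff)

lemma monomial_U_act: "Poly_Mapping.keys (U_act u (bvec {#})) \<subseteq> Collect monomial"
proof (induction u rule: uea_induct)
  case (mult x u)
  have "Poly_Mapping.keys (act (basis i) (bvec M)) \<subseteq> Collect monomial" for i M
    using keys_act[OF subadditive_zero, of i M] by blast
  then have "Poly_Mapping.keys (act x (bvec M)) \<subseteq> Collect monomial" for M
    by (induction x rule: basis_induct)
       (simp_all add: act_add_left act_cscale_left keys_add_subset keys_cscale_subset)
  then have "Poly_Mapping.keys (lin_ext (\<lambda>M. act x (bvec M)) (U_act u (bvec {#}))) \<subseteq> Collect monomial"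
    by (intro keys_lin_ext_subset)
  then show ?case
    by (simp add: U_act_mult U_act_uea_of lin_ext_bvec_self flip: act_lin_ext_right del: single_one)
qed (simp_all add: U_act_one U_act_add_left U_act_cscale_left keys_add_subset keys_cscale_subset
    monomial_empty)

definition U_monomial :: "'i multiset \<Rightarrow> 'l uea" where
  "U_monomial M = prod_list (map (\<lambda>i. uea_of (basis i)) (sorted_list_of_multiset M))"

lemma U_monomial_empty: "U_monomial {#} = 1"
  by (simp add: U_monomial_def)

lemma U_monomial_add_mset: "\<forall>k\<in>#N. j \<le> k \<Longrightarrow> U_monomial (add_mset j N) = uea_of (basis j) * U_monomial N"
  by (simp add: U_monomial_def insort_is_Cons)

text \<open>Let \<open>K\<close> be any left ideal that contains \<open>x - \<chi>(x)\<close> for the basis elements \<open>x\<close> of the subalgebra. Modulo \<open>K\<close>, ordered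
  products of basis elements satisfy the same recursion as the multisets in the model, so the map sending a
  multiset to its ordered product is equivariant, and every \<open>u\<close> is congruent to the image of
  \<open>u\<close> applied to the cyclic vector. This is the spanning half of the Poincare-Birkhoff-Witt theorem.\<close>

context
  fixes K :: "'l uea set"
  assumes K_add: "u \<in> K \<Longrightarrow> v \<in> K \<Longrightarrow> u + v \<in> K"
    and K_mult: "v \<in> K \<Longrightarrow> u * v \<in> K"
    and K_character: "i \<in> P \<Longrightarrow> uea_of (basis i) - \<chi> i *\<^sub>C 1 \<in> K"
    and K_zero: "0 \<in> K"
begin

lemma K_cscale: "v \<in> K \<Longrightarrow> c *\<^sub>C v \<in> K"
  using K_mult[of v "c *\<^sub>C 1"] by (simp add: cscale_mult_left)

lemma U_monomial_equivariant_extend: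
  assumes "\<And>M i. M \<in> Poly_Mapping.keys q \<Longrightarrow>
    uea_of (basis i) * U_monomial M - lin_ext U_monomial (act (basis i) (bvec M)) \<in> K"
  shows "uea_of x * lin_ext U_monomial q - lin_ext U_monomial (act x q) \<in> K"
proof -
  let ?D = "\<lambda>x M. uea_of x * U_monomial M - lin_ext U_monomial (act x (bvec M))"
  have D: "?D x M \<in> K" if "M \<in> Poly_Mapping.keys q" for M
  proof (induction x rule: basis_induct)
    case (add x y)
    have "?D (x + y) M = ?D x M + ?D y M"
      by (simp add: uea_of_add act_add_left lin_ext_add algebra_simps)
    then show ?case using add by (simp add: K_add)
  next
    case (scale c x)
    have "?D (c *\<^sub>C x) M = c *\<^sub>C ?D x M"
      by (simp add: uea_of_cscale act_cscale_left lin_ext_cscale cscale_mult_left cvs.scale_right_diff_distrib)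
    then show ?case using scale by (simp add: K_cscale)
  qed (use assms that in blast)
  have sum: "lin_ext (?D x) p \<in> K" if "Poly_Mapping.keys p \<subseteq> Poly_Mapping.keys q" for p
  proof -
    have "(\<Sum>M\<in>S. Poly_Mapping.lookup p M *\<^sub>C ?D x M) \<in> K"
      if "finite S" "S \<subseteq> Poly_Mapping.keys q" for S
      using that by (induction S) (simp_all add: K_zero K_add K_cscale D)
    with that show ?thesis by (simp add: lin_ext_def)
  qed
  have "uea_of x * lin_ext U_monomial q = lin_ext (\<lambda>M. uea_of x * U_monomial M) q"
    by (rule linear_lin_ext) (simp_all add: algebra_simps cscale_mult_right)
  moreover have "act x q = lin_ext (\<lambda>M. act x (bvec M)) q"
    using act_lin_ext_right[of x bvec q] by (simp add: lin_ext_bvec_self)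
  moreover have "lin_ext U_monomial (lin_ext (\<lambda>M. act x (bvec M)) q)
      = lin_ext (\<lambda>M. lin_ext U_monomial (act x (bvec M))) q"
    by (rule linear_lin_ext) (simp_all add: lin_ext_add lin_ext_cscale)
  ultimately show ?thesis using sum[of q] by (simp add: lin_ext_diff_fun)
qed

lemma U_monomial_equivariant:
  assumes "monomial M"
  shows "uea_of (basis i) * U_monomial M - lin_ext U_monomial (act (basis i) (bvec M)) \<in> K"
  using assms
proof (induction M arbitrary: i rule: measure_induct_rule[of size])
  case (less M)
  from less.prems show ?case
  proof (cases M rule: monomial_cases)
    case empty
    then show ?thesis
      using K_character[of i] K_zero act_lead[of i "{#}"]
      by (cases "i \<in> P") (simp_all add: act_character U_monomial_empty lin_ext_cscale U_monomial_add_mset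
          monomial_empty del: single_one)
  next
    case (add j N)
    show ?thesis
    proof (cases "i \<le> j")
      case True
      then have "i \<notin> P" using P_upper[of j i] add(2) by fastforce
      have "\<forall>k\<in>#M. i \<le> k" using True add by auto
      then show ?thesis
        using act_lead[OF \<open>i \<notin> P\<close> less.prems] K_zero by (simp add: U_monomial_add_mset)
    next
      case False
      then have "j < i" by simp
      let ?t = "lin_ext U_monomial"
      have IH: "uea_of x * ?t q - ?t (act x q) \<in> K"
        if "\<And>K. K \<in> Poly_Mapping.keys q \<Longrightarrow> monomial K \<and> size K < size M" for x q
        by (rule U_monomial_equivariant_extend) (use that less.IH in blast)
      define w where "w = act (basis i) (bvec N) - lead i N"
      have w: "act (basis i) (bvec N) = lead i N + w" by (simp add: w_def)
      have 1: "uea_of (basis j) * (uea_of (basis i) * U_monomial N - ?t (lead i N + w)) \<in> K"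
        using IH[of "bvec N" "basis i"] add K_mult by (simp add: w)
      have 2: "uea_of (basis j) * ?t w - ?t (act (basis j) w) \<in> K"
      proof (rule IH)
        fix K assume "K \<in> Poly_Mapping.keys w"
        with keys_act_lead[OF subadditive_zero, of i N] add
        show "monomial K \<and> size K < size M" by (auto simp: w_def)
      qed
      have 3: "uea_of (bracket (basis i) (basis j)) * U_monomial N
          - ?t (act (bracket (basis i) (basis j)) (bvec N)) \<in> K"
        using IH[of "bvec N"] add by simp
      have 4: "?t (act (basis j) (lead i N)) = uea_of (basis j) * ?t (lead i N)"
        using act_lead[of j "add_mset i N"] U_monomial_add_mset[of "add_mset i N" j] add \<open>j < i\<close>
        by (auto simp: lead_def monomial_add_mset)
      have "uea_of (basis i) * U_monomial M - ?t (act (basis i) (bvec M)) =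
          uea_of (basis j) * (uea_of (basis i) * U_monomial N - ?t (lead i N + w))
          + (uea_of (basis j) * ?t w - ?t (act (basis j) w))
          + (uea_of (bracket (basis i) (basis j)) * U_monomial N
             - ?t (act (bracket (basis i) (basis j)) (bvec N)))"
        using act_straighten[of j N i] U_monomial_add_mset[of N j] add 4
        by (simp add: w act_add_right lin_ext_add uea_of_bracket algebra_simps)
      with 1 2 3 show ?thesis by (simp add: K_add)
    qed
  qed
qed

theorem U_act_section: "u - lin_ext U_monomial (U_act u (bvec {#})) \<in> K"
proof (induction u rule: uea_induct)
  case one
  then show ?case by (simp add: U_act_one U_monomial_empty K_zero del: single_one)
next
  case (add u v)
  from K_add[OF this] show ?case by (simp add: U_act_add_left lin_ext_add algebra_simps del: single_one)
next
  case (scale c u)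
  from K_cscale[OF this, of c] show ?case
    by (simp add: U_act_cscale_left lin_ext_cscale cvs.scale_right_diff_distrib del: single_one)
next
  case (mult x u)
  let ?q = "U_act u (bvec {#})"
  have "uea_of x * lin_ext U_monomial ?q - lin_ext U_monomial (act x ?q) \<in> K"
    by (rule U_monomial_equivariant_extend) (use monomial_U_act U_monomial_equivariant in blast)
  from K_add[OF K_mult[OF mult, of "uea_of x"] this] show ?case
    by (simp add: U_act_mult U_act_uea_of algebra_simps del: single_one)
qed

end
end

section \<open>The Whittaker module as an induced module\<close>

text \<open>An injective enumeration of the basis by the integers, in which exactly the indices of \<open>sv\<^sup>+\<close> get
  nonnegative numbers.\<close>

fun sv_rank :: "sv_index \<Rightarrow> int" where
  "sv_rank (Ind_L n) = 3 * n - 3"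
| "sv_rank (Ind_M n) = 3 * n - 2"
| "sv_rank (Ind_Y n) = 3 * n + 2"

lemma sv_rank_inject: "sv_rank a = sv_rank b \<Longrightarrow> a = b"
  by (cases a; cases b; simp; presburger)

instantiation sv_index :: linorder
begin
definition less_eq_sv_index :: "sv_index \<Rightarrow> sv_index \<Rightarrow> bool" where
  "a \<le> b \<longleftrightarrow> sv_rank a \<le> sv_rank b"
definition less_sv_index :: "sv_index \<Rightarrow> sv_index \<Rightarrow> bool" where
  "a < b \<longleftrightarrow> sv_rank a < sv_rank b"
instance
  by standard (auto simp: less_eq_sv_index_def less_sv_index_def intro: sv_rank_inject)
end

definition sv_plus_index :: "sv_index set" where
  "sv_plus_index = {a. 0 \<le> sv_rank a}"

lemma sv_plus_index_simps:
  "Ind_L n \<in> sv_plus_index \<longleftrightarrow> n \<ge> 1"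
  "Ind_M n \<in> sv_plus_index \<longleftrightarrow> n \<ge> 1"
  "Ind_Y n \<in> sv_plus_index \<longleftrightarrow> n \<ge> 0"
  by (auto simp: sv_plus_index_def)

lemma sv_plus_gens_eq: "sv_plus_gens = sv_basis ` sv_plus_index"
proof (intro equalityI subsetI)
  fix x assume "x \<in> sv_basis ` sv_plus_index"
  then obtain a where "x = sv_basis a" "a \<in> sv_plus_index" by blast
  then show "x \<in> sv_plus_gens"
    by (cases a) (auto simp: sv_plus_gens_def sv_plus_index_simps)
next
  fix x assume "x \<in> sv_plus_gens"
  then consider n where "x = sv_basis (Ind_L n)" "n \<ge> 1" | n where "x = sv_basis (Ind_M n)" "n \<ge> 1"
    | n where "x = sv_basis (Ind_Y n)" "n \<ge> 0"
    by (auto simp: sv_plus_gens_def)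
  then show "x \<in> sv_basis ` sv_plus_index"
    by cases (auto intro!: imageI simp: sv_plus_index_simps simp del: sv_basis.simps)
qed

lemma sv_basis_in_span: "a \<in> sv_plus_index \<Longrightarrow> sv_basis a \<in> cvs.span sv_plus_gens"
  by (auto simp: sv_plus_gens_eq intro!: cvs.span_base)

lemma sv_plus_incl_basis: "a \<in> sv_plus_index \<Longrightarrow> sv_plus_incl (to_sv_plus (sv_basis a)) = sv_basis a"
  by (rule to_sv_plus_inverse) (rule sv_basis_in_span)

lemma sv_plus_induct [case_names add scale basis]:
  assumes "\<And>x y. Q x \<Longrightarrow> Q y \<Longrightarrow> Q (x + y)" "\<And>c x. Q x \<Longrightarrow> Q (c *\<^sub>C x)"
    and "\<And>a. a \<in> sv_plus_index \<Longrightarrow> Q (to_sv_plus (sv_basis a))"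
  shows "Q x"
proof -
  have "y \<in> cvs.span sv_plus_gens \<and> Q (to_sv_plus y)" if "y \<in> cvs.span sv_plus_gens" for y
    using that
  proof (induction y rule: cvs.span_induct_alt)
    case base
    have "Q (0 *\<^sub>C to_sv_plus (sv_basis (Ind_L 1)))" by (intro assms) (simp add: sv_plus_index_simps)
    then show ?case by (simp add: zero_sv_plus_def cvs.span_zero)
  next
    case (step c g y)
    then obtain a where a: "a \<in> sv_plus_index" "g = sv_basis a" by (auto simp: sv_plus_gens_eq)
    have "Q (c *\<^sub>C to_sv_plus g + to_sv_plus y)" using a step by (simp add: assms)
    moreover have "c *\<^sub>C to_sv_plus g + to_sv_plus y = to_sv_plus (c *\<^sub>C g + y)"
      using a step sv_basis_in_span[OF a(1)]
      by (simp add: cscale_sv_plus.abs_eq plus_sv_plus.abs_eq eq_onp_def cvs.span_scale)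
    ultimately show ?case
      using a step sv_basis_in_span[OF a(1)] by (simp add: cvs.span_add cvs.span_scale)
  qed
  from this[OF sv_plus_incl] show ?thesis by (simp add: sv_plus_incl_inverse)
qed

lemma sv_coords_add: "sv_coords (x + y) = sv_coords x + sv_coords y"
  by (rule plus_sv.rep_eq)

lemma sv_coords_cscale: "sv_coords (c *\<^sub>C x) = c *\<^sub>C sv_coords x"
  by (rule poly_mapping_eqI) (simp add: cscale_sv.rep_eq lookup_map_scale lookup_cscale cscale_complex)

lemma sv_coords_basis: "sv_coords (sv_basis a) = bvec a"
  by (cases a) (simp_all add: sv_L.rep_eq sv_M.rep_eq sv_Y.rep_eq)

lemma lin_ext_sv_basis_coords: "lin_ext sv_basis (sv_coords x) = x"
  by (induction x rule: sv_induct)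
     (simp_all add: sv_coords_add sv_coords_cscale sv_coords_basis lin_ext_add lin_ext_cscale)

lemma bracket_sv_basis: "bracket (sv_basis a) (sv_basis b) = basis_bracket a b"
  by (simp add: bracket_sv_def sv_bracket_basis)

lemma keys_sv_coords_cscale:
  "Poly_Mapping.keys (sv_coords (c *\<^sub>C sv_basis a)) = (if c = 0 then {} else {a})"
  by (auto simp: sv_coords_cscale sv_coords_basis cscale_single)

lemma keys_basis_bracket:
  "k \<in> Poly_Mapping.keys (sv_coords (basis_bracket a b)) \<Longrightarrow>
    (case (a, b) of (Ind_L m, Ind_L n) \<Rightarrow> k = Ind_L (m + n) | (Ind_L m, Ind_M n) \<Rightarrow> k = Ind_M (m + n)
    | (Ind_L m, Ind_Y n) \<Rightarrow> k = Ind_Y (m + n) | (Ind_Y m, Ind_Y n) \<Rightarrow> k = Ind_M (m + n + 1)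
    | (Ind_M n, Ind_L m) \<Rightarrow> k = Ind_M (m + n) | (Ind_Y n, Ind_L m) \<Rightarrow> k = Ind_Y (m + n) | _ \<Rightarrow> False)"
proof -
  have uminus: "Poly_Mapping.keys (sv_coords (- x)) = Poly_Mapping.keys (sv_coords x)" for x
    using sv_coords_cscale[of "- 1" x] by simp
  have zero: "sv_coords 0 = 0" by (rule zero_sv.rep_eq)
  show "k \<in> Poly_Mapping.keys (sv_coords (basis_bracket a b)) \<Longrightarrow> ?thesis"
    using keys_sv_coords_cscale[of _ "Ind_L _"] keys_sv_coords_cscale[of _ "Ind_M _"]
      keys_sv_coords_cscale[of _ "Ind_Y _"]
    by (cases a; cases b) (auto simp: uminus zero split: if_splits simp del: of_int_add of_int_diff)
qed

locale whittaker_type =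
  fixes \<psi> :: "sv_plus \<Rightarrow> complex"
  assumes lie_hom_\<psi>: "lie_hom \<psi>"
begin

definition \<chi> :: "sv_index \<Rightarrow> complex" where
  "\<chi> a = \<psi> (to_sv_plus (sv_basis a))"

lemma \<psi>_add: "\<psi> (x + y) = \<psi> x + \<psi> y"
  and \<psi>_cscale: "\<psi> (c *\<^sub>C x) = c * \<psi> x"
  and \<psi>_bracket: "\<psi> (bracket x y) = 0"
  using lie_hom_\<psi> by (simp_all add: lie_hom_def linear_cscale_iff cscale_complex mult.commute)

lemma \<psi>_coords: "\<psi> x = lin_ext \<chi> (sv_coords (sv_plus_incl x))"
  by (induction x rule: sv_plus_induct)
    (simp_all add: \<psi>_add \<psi>_cscale plus_sv_plus.rep_eq cscale_sv_plus.rep_eq sv_coords_add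
      sv_coords_cscale lin_ext_add lin_ext_cscale cscale_complex sv_plus_incl_basis sv_coords_basis \<chi>_def)

sublocale induced_module sv_basis sv_coords sv_plus_index \<chi>
proof
  fix i j assume ij: "i \<in> sv_plus_index" "j \<in> sv_plus_index"
  show "Poly_Mapping.keys (sv_coords (bracket (sv_basis i) (sv_basis j))) \<subseteq> sv_plus_index"
    unfolding bracket_sv_basis
  proof
    fix k assume "k \<in> Poly_Mapping.keys (sv_coords (basis_bracket i j))"
    from keys_basis_bracket[OF this] ij show "k \<in> sv_plus_index"
      by (cases i; cases j) (auto simp: sv_plus_index_simps)
  qed
  have "bracket (sv_basis i) (sv_basis j)
      = sv_plus_incl (bracket (to_sv_plus (sv_basis i)) (to_sv_plus (sv_basis j)))"
    using ij by (simp add: bracket_sv_plus.rep_eq sv_plus_incl_basis)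
  then show "lin_ext \<chi> (sv_coords (bracket (sv_basis i) (sv_basis j))) = 0"
    by (simp add: \<psi>_bracket flip: \<psi>_coords)
next
  fix i j assume "i \<notin> sv_plus_index" "j \<in> sv_plus_index"
  then show "i < j" by (simp add: sv_plus_index_def less_sv_index_def)
qed (simp_all add: sv_coords_add sv_coords_cscale sv_coords_basis lin_ext_sv_basis_coords)

abbreviation vac :: "sv_index multiset \<Rightarrow>\<^sub>0 complex" where
  "vac \<equiv> bvec {#}"

lemma act_vac: "act (sv_plus_incl x) vac = \<psi> x *\<^sub>C vac"
  by (induction x rule: sv_plus_induct)
    (simp_all add: plus_sv_plus.rep_eq cscale_sv_plus.rep_eq act_add_left act_cscale_left \<psi>_add \<psi>_cscale
      cscale_add_left cscale_cscale sv_plus_incl_basis act_character flip: \<chi>_def del: single_one)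

abbreviation incl_U :: "sv_plus uea \<Rightarrow> sv uea" where
  "incl_U \<equiv> uea_lift (\<lambda>x. uea_of (sv_plus_incl x))"

lemma incl_U_simps:
  "incl_U 1 = 1" "incl_U (r * s) = incl_U r * incl_U s" "incl_U (r + s) = incl_U r + incl_U s"
  "incl_U (c *\<^sub>C r) = c *\<^sub>C incl_U r" "incl_U (uea_of x) = uea_of (sv_plus_incl x)"
  using alg_hom_uea_lift[OF lie_hom_sv_plus_incl]
  by (simp_all add: alg_hom_def linear_cscale_iff uea_lift_uea_of[OF lie_hom_sv_plus_incl])

lemma \<psi>_U_simps:
  "uea_lift \<psi> 1 = 1" "uea_lift \<psi> (r * s) = uea_lift \<psi> r * uea_lift \<psi> s"
  "uea_lift \<psi> (r + s) = uea_lift \<psi> r + uea_lift \<psi> s" "uea_lift \<psi> (c *\<^sub>C r) = c * uea_lift \<psi> r"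
  "uea_lift \<psi> (uea_of x) = \<psi> x"
  using alg_hom_uea_lift[OF lie_hom_\<psi>]
  by (simp_all add: alg_hom_def linear_cscale_iff cscale_complex uea_lift_uea_of[OF lie_hom_\<psi>])

lemma U_act_incl_U_vac: "U_act (incl_U r) vac = uea_lift \<psi> r *\<^sub>C vac"
  by (induction r rule: uea_induct)
    (simp_all add: incl_U_simps \<psi>_U_simps U_act_one U_act_add_left U_act_cscale_left U_act_mult
      U_act_uea_of act_cscale_right act_vac cscale_add_left cscale_cscale mult.commute del: single_one)

abbreviation null :: "(sv uea \<times> complex \<Rightarrow>\<^sub>0 int) set" where
  "null \<equiv> tensor_null U_plus_ract (C_psi_lact \<psi>)"

abbreviation tens :: "sv uea \<Rightarrow> whittaker_vec" where
  "tens u \<equiv> pure_tensor U_plus_ract (C_psi_lact \<psi>) u 1"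

lemma null_zero: "0 \<in> null"
  and null_diff: "f \<in> null \<Longrightarrow> g \<in> null \<Longrightarrow> f - g \<in> null"
  using is_subgroup_tensor_null by (auto simp: is_subgroup_def)

lemma null_add: "f \<in> null \<Longrightarrow> g \<in> null \<Longrightarrow> f + g \<in> null"
  using null_diff[of f "0 - g"] null_diff[OF null_zero] by simp

lemma null_add_left: "frag_of (m + m', n) - frag_of (m, n) - frag_of (m', n) \<in> null"
  and null_balanced: "frag_of (m * incl_U r, n) - frag_of (m, uea_lift \<psi> r * n) \<in> null"
  unfolding tensor_null_def U_plus_ract_def C_psi_lact_def by (rule hull_inc; blast)+

lemma pure_tensor_eq_iff:
  "pure_tensor U_plus_ract (C_psi_lact \<psi>) m n = pure_tensor U_plus_ract (C_psi_lact \<psi>) m' n'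
    \<longleftrightarrow> frag_of (m, n) - frag_of (m', n') \<in> null"
  using eq_equiv_class_iff[OF equiv_tensor_rel, of "frag_of (m, n)" "frag_of (m', n')"]
  by (simp add: pure_tensor_def tensor_rel_def)

lemma null_scale: "frag_of (c *\<^sub>C m, n) - frag_of (m, c * n) \<in> null"
  using null_balanced[of m "c *\<^sub>C 1" n] by (simp add: incl_U_simps \<psi>_U_simps cscale_mult_right)

lemma null_diff_left: "frag_of (m - m', n) - (frag_of (m, n) - frag_of (m', n)) \<in> null"
  using null_diff[OF null_zero null_add_left[of "m - m'" m' n]] by (simp add: algebra_simps)

lemma tens_eq_iff: "tens u = tens u' \<longleftrightarrow> frag_of (u - u', 1) \<in> null"
proof -
  have "f \<in> null \<longleftrightarrow> g \<in> null" if "f - g \<in> null" for f g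
    using that null_add[of "f - g" g] null_diff[of f "f - g"] by auto
  from this[OF null_diff_left] show ?thesis by (simp add: pure_tensor_eq_iff)
qed

lemma whittaker_module_tens:
  assumes "v \<in> whittaker_module \<psi>"
  obtains u where "v = tens u"
proof -
  obtain f where f: "v = tensor_rel U_plus_ract (C_psi_lact \<psi>) `` {f}"
    using assms by (auto simp: whittaker_module_def tensor_space_def quotient_def)
  have "\<exists>u. f - frag_of (u, 1) \<in> null"
  proof (rule frag_induction[of f UNIV])
    show "\<exists>u. 0 - frag_of (u, 1) \<in> null"
      using null_add_left[of 0 0 1] by (intro exI[of _ 0]) simp
  next
    fix x :: "sv uea \<times> complex"
    obtain m n where x: "x = (m, n)" by fastforce
    have "frag_of x - frag_of (n *\<^sub>C m, 1) \<in> null"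
      using null_diff[OF null_zero null_scale[of n m 1]] by (simp add: x)
    then show "\<exists>u. frag_of x - frag_of (u, 1) \<in> null" ..
  next
    fix a b :: "sv uea \<times> complex \<Rightarrow>\<^sub>0 int"
    assume "\<exists>u. a - frag_of (u, 1) \<in> null" "\<exists>u. b - frag_of (u, 1) \<in> null"
    then obtain u u' where "a - frag_of (u, 1) \<in> null" "b - frag_of (u', 1) \<in> null" by blast
    from null_diff[OF null_diff[OF this] null_diff_left[of u u' 1]]
    show "\<exists>u. a - b - frag_of (u, 1) \<in> null" by (intro exI[of _ "u - u'"]) (simp add: algebra_simps)
  qed simp
  then obtain u where "f - frag_of (u, 1) \<in> null" ..
  then have "v = tens u"
    unfolding f pure_tensor_def by (intro equiv_class_eq[OF equiv_tensor_rel]) (simp add: tensor_rel_def)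
  with that show thesis .
qed

text \<open>The assignment \<open>u \<otimes> c \<mapsto> c u vac\<close> is well defined on the tensor product; \<open>\<Phi>\<close> is its lift to the free
  abelian group on pairs.\<close>

lemma tens_eq_U_act:
  assumes "tens u = tens u'"
  shows "U_act u vac = U_act u' vac"
proof -
  define \<Phi> where "\<Phi> f = lin_ext (\<lambda>(u, c). c *\<^sub>C U_act u vac) (Poly_Mapping.map of_int f)"
    for f :: "sv uea \<times> complex \<Rightarrow>\<^sub>0 int"
  have "Poly_Mapping.map of_int (f - g) = Poly_Mapping.map of_int f - (Poly_Mapping.map of_int g :: _ \<Rightarrow>\<^sub>0 complex)"
    for f g :: "sv uea \<times> complex \<Rightarrow>\<^sub>0 int"
    by (rule poly_mapping_eqI) (simp add: Poly_Mapping.map.rep_eq lookup_minus when_def)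
  then have diff: "\<Phi> (f - g) = \<Phi> f - \<Phi> g" for f g
    by (simp add: \<Phi>_def lin_ext_diff)
  have of: "\<Phi> (frag_of (u, c)) = c *\<^sub>C U_act u vac" for u c
    by (simp add: \<Phi>_def map_single)
  have "null \<subseteq> {f. \<Phi> f = 0}"
    unfolding tensor_null_def U_plus_ract_def C_psi_lact_def
  proof (rule hull_minimal)
    show "is_subgroup {f. \<Phi> f = 0}" using diff[of 0 0] by (simp add: is_subgroup_def diff)
  qed (auto simp: diff of U_act_add_left cscale_add_left cscale_add_right U_act_mult U_act_incl_U_vac
      U_act_cscale_right cscale_cscale mult.commute simp del: single_one)
  with assms have "\<Phi> (frag_of (u, 1) - frag_of (u', 1)) = 0"
    by (auto simp: pure_tensor_eq_iff)
  then show ?thesis by (simp add: diff of)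
qed

text \<open>The elements \<open>u\<close> with \<open>u \<otimes> 1 = 0\<close> form a left ideal to which the spanning argument applies. Hence \<open>u \<otimes> 1\<close>
  can be recovered from \<open>u\<close> applied to the cyclic vector of the model.\<close>

lemma tens_section: "tens u = tens (lin_ext U_monomial (U_act u vac))"
proof -
  have "u - lin_ext U_monomial (U_act u vac) \<in> {u. frag_of (u, 1) \<in> null}"
  proof (rule U_act_section)
    fix u v assume "u \<in> {u. frag_of (u, 1) \<in> null}" "v \<in> {u. frag_of (u, 1) \<in> null}"
    then show "u + v \<in> {u. frag_of (u, 1) \<in> null}"
      using null_add[OF null_add[OF null_add_left[of u v 1]], of "frag_of (u, 1)" "frag_of (v, 1)"] by simp
  next
    fix u v assume "v \<in> {u. frag_of (u, 1) \<in> null}"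
    then have "tens v = tens 0" by (simp add: tens_eq_iff)
    then have "whittaker_act \<psi> u (tens v) = whittaker_act \<psi> u (tens 0)" by simp
    then show "u * v \<in> {u. frag_of (u, 1) \<in> null}"
      by (simp add: whittaker_act_pure_tensor tens_eq_iff)
  next
    fix i assume i: "i \<in> sv_plus_index"
    have "frag_of (uea_of (sv_basis i), 1) - frag_of (1, \<chi> i) \<in> null"
      using null_balanced[of 1 "uea_of (to_sv_plus (sv_basis i))" 1] i
      by (simp add: incl_U_simps \<psi>_U_simps sv_plus_incl_basis \<chi>_def)
    from null_diff[OF this null_scale[of "\<chi> i" 1 1]]
    have "tens (uea_of (sv_basis i)) = tens (\<chi> i *\<^sub>C 1)"
      by (simp add: pure_tensor_eq_iff)
    then show "uea_of (sv_basis i) - \<chi> i *\<^sub>C 1 \<in> {u. frag_of (u, 1) \<in> null}"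
      by (simp add: tens_eq_iff)
  next
    have "tens 0 = tens 0" ..
    then show "0 \<in> {u. frag_of (u, 1) \<in> null}" unfolding tens_eq_iff by simp
  qed
  then show ?thesis by (simp add: tens_eq_iff)
qed

lemma tens_uea_of: "tens (u * uea_of (sv_plus_incl x)) = tens (\<psi> x *\<^sub>C u)"
  using null_diff[OF null_balanced[of u "uea_of x" 1] null_scale[of "\<psi> x" u 1]]
  by (simp add: pure_tensor_eq_iff incl_U_simps \<psi>_U_simps)

lemma is_whittaker_vector_tens:
  "is_whittaker_vector \<psi> (tens u) \<longleftrightarrow> (\<forall>x. tens (uea_of (sv_plus_incl x) * u) = tens (\<psi> x *\<^sub>C u))"
proof -
  have "tens u \<in> whittaker_module \<psi>"
    by (simp add: whittaker_module_def tensor_space_def pure_tensor_def quotientI)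
  then show ?thesis
    by (simp add: is_whittaker_vector_def whittaker_act_pure_tensor whittaker_scale_pure_tensor)
qed

lemma act_whittaker_vector:
  assumes "is_whittaker_vector \<psi> (tens u)" "i \<in> sv_plus_index"
  shows "act (sv_basis i) (U_act u vac) = \<chi> i *\<^sub>C U_act u vac"
proof -
  from assms(1) have "tens (uea_of (sv_plus_incl (to_sv_plus (sv_basis i))) * u) = tens (\<psi> (to_sv_plus (sv_basis i)) *\<^sub>C u)"
    unfolding is_whittaker_vector_tens by blast
  from tens_eq_U_act[OF this] assms(2) show ?thesis
    by (simp add: sv_plus_incl_basis \<chi>_def U_act_mult U_act_uea_of U_act_cscale_left del: single_one)
qed

end

section \<open>Whittaker vectors\<close>

lemma is_subalgebra_M0_polys: "is_subalgebra M0_polys"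
  unfolding M0_polys_def by (rule hull_in) (auto simp: is_subalgebra_def intro!: cvs.subspace_Inter)

lemma M0_polys_central:
  assumes "u \<in> M0_polys"
  shows "uea_of x * u = u * uea_of x"
proof -
  have "uea_of x * uea_of (sv_M 0) = uea_of (sv_M 0) * uea_of x" for x
  proof -
    have "bracket x (sv_M 0) = 0"
    proof (induction x rule: sv_induct)
      case (basis a)
      show ?case using bracket_sv_basis[of a "Ind_M 0"] by (cases a) simp_all
    qed (simp_all add: bracket_add_left bracket_cscale_left)
    then have "uea_of x * uea_of (sv_M 0) - uea_of (sv_M 0) * uea_of x = 0"
      using uea_of_bracket[of x "sv_M 0"] uea_of_cscale[of 0 "0 :: sv"] by simp
    then show ?thesis by simp
  qed
  then have "uea_of (sv_M 0) \<in> {u. uea_of x * u = u * uea_of x}" by simp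
  moreover have "is_subalgebra {u. uea_of x * u = u * uea_of x}"
    unfolding is_subalgebra_def cvs.subspace_def
    by (auto simp: algebra_simps cscale_mult_left cscale_mult_right) (metis mult.assoc)
  ultimately show ?thesis
    using assms hull_minimal[of "{uea_of (sv_M 0)}" "{u. uea_of x * u = u * uea_of x}" is_subalgebra]
    unfolding M0_polys_def by blast
qed

fun sv_index_num :: "sv_index \<Rightarrow> int" where
  "sv_index_num (Ind_L n) = n"
| "sv_index_num (Ind_M n) = n"
| "sv_index_num (Ind_Y n) = n"

text \<open>The bracket of \<open>partner b\<close> with \<open>b\<close> is a multiple of \<open>M\<^sub>1\<close>. With another index \<open>j\<close>, whose number is greater
  by \<open>d\<close>, it is \<open>pairing b j\<close> times \<open>M\<^bsub>d+1\<^esub>\<close> provided that \<open>pairs_with b j\<close>. This condition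
  keeps \<open>j\<close> away from the types of factors that are removed before the type of \<open>b\<close>.\<close>

fun partner :: "sv_index \<Rightarrow> sv_index" where
  "partner (Ind_L n) = Ind_M (1 - n)"
| "partner (Ind_M n) = Ind_L (1 - n)"
| "partner (Ind_Y n) = Ind_Y (- n)"

fun pairing :: "sv_index \<Rightarrow> sv_index \<Rightarrow> complex" where
  "pairing (Ind_L n) (Ind_L k) = of_int (n - 1)"
| "pairing (Ind_M n) (Ind_M k) = of_int k"
| "pairing (Ind_Y n) (Ind_Y k) = of_int (n + k)"
| "pairing _ _ = 0"

fun pairs_with :: "sv_index \<Rightarrow> sv_index \<Rightarrow> bool" where
  "pairs_with (Ind_L _) _ = True"
| "pairs_with (Ind_Y _) j = (\<forall>k. j \<noteq> Ind_L k)"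
| "pairs_with (Ind_M _) j = (\<exists>k. j = Ind_M k)"

lemma bracket_partner:
  "pairs_with b j \<Longrightarrow> bracket (sv_basis (partner b)) (sv_basis j) =
    pairing b j *\<^sub>C sv_M (sv_index_num j - sv_index_num b + 1)"
  unfolding bracket_sv_basis by (cases b; cases j) (auto simp: algebra_simps cvs.scale_left_diff_distrib)

fun deg_L :: "sv_index \<Rightarrow> nat" where
  "deg_L (Ind_L _) = 1"
| "deg_L _ = 0"

context whittaker_type
begin

lemma subadditive_deg_L: "subadditive deg_L"
  unfolding subadditive_def
proof (intro allI ballI)
  fix i j k assume "k \<in> Poly_Mapping.keys (br i j)"
  then show "deg_L k \<le> deg_L i + deg_L j"
    unfolding bracket_sv_basis using keys_basis_bracket[of k i j]
    by (cases i; cases j) auto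
qed

text \<open>Only brackets of \<open>M\<^sub>m\<close> with factors \<open>L\<close> are nonzero. They replace such a factor by an \<open>M\<close>, so every correction
  to the scalar action has fewer factors \<open>L\<close>.\<close>

lemma act_M_bvec:
  assumes "m \<ge> 1" "monomial N"
  shows "Poly_Mapping.keys (act (sv_M m) (bvec N) - \<chi> (Ind_M m) *\<^sub>C bvec N)
    \<subseteq> {K. weight deg_L K + 1 \<le> weight deg_L N}"
proof -
  have "Poly_Mapping.keys (act (sv_basis (Ind_M m)) (bvec N) - \<chi> (Ind_M m) *\<^sub>C bvec N
      - (0 * of_nat (count N (Ind_M m))) *\<^sub>C bvec (N - {#Ind_M m#}))
    \<subseteq> {K. weight deg_L K + 1 \<le> weight deg_L N}"
  proof (rule act_derivation[OF subadditive_deg_L])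
    fix j N'
    have "Poly_Mapping.keys (act (bracket (sv_basis (Ind_M m)) (sv_basis j)) (bvec N'))
        \<subseteq> {K. weight deg_L K + 1 \<le> weight deg_L N' + deg_L j}"
    proof (cases "\<exists>k. j = Ind_L k")
      case True
      then obtain k where "j = Ind_L k" by blast
      then show ?thesis
        using keys_act[OF subadditive_deg_L, of "Ind_M (k + m)" N'] bracket_sv_basis[of "Ind_M m" j]
          keys_cscale_subset[of "act (sv_M (k + m)) (bvec N')" "{K. weight deg_L K \<le> weight deg_L N'}" "- of_int m"]
        by (auto simp: act_uminus_left act_cscale_left)
    next
      case False
      then have "bracket (sv_basis (Ind_M m)) (sv_basis j) = 0"
        using bracket_sv_basis[of "Ind_M m" j] by (cases j) auto
      then show ?thesis by simp
    qed
    then show "Poly_Mapping.keys (act (bracket (sv_basis (Ind_M m)) (sv_basis j)) (bvec N')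
        - (if j = Ind_M m then 0 else 0) *\<^sub>C bvec N') \<subseteq> {K. weight deg_L K + 1 \<le> weight deg_L N' + deg_L j}"
      by simp
  qed (use assms in \<open>simp_all add: sv_plus_index_simps\<close>)
  then show ?thesis by simp
qed

lemma deg_L_pairing: "pairing b j \<noteq> 0 \<Longrightarrow> deg_L b \<le> deg_L j"
  by (cases b; cases j) auto

text \<open>One stage of the elimination, for a set \<open>T\<close> of indices of one type, with the number of factors \<open>L\<close> as weight.
  The height of an index is its distance below zero: a factor of smaller height than \<open>b\<close> pairs with
  \<open>partner b\<close> to a multiple of some \<open>M\<^sub>m\<close> with \<open>m \<ge> 2\<close>, on which \<open>\<psi>\<close> vanishes.\<close>

lemma whittaker_support_disjoint:
  assumes \<chi>_M1: "\<chi> (Ind_M 1) \<noteq> 0" and \<chi>_M: "\<And>m. m \<ge> 2 \<Longrightarrow> \<chi> (Ind_M m) = 0"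
    and p: "Poly_Mapping.keys p \<subseteq> Collect monomial"
    and whittaker: "\<And>i. i \<in> sv_plus_index \<Longrightarrow> act (sv_basis i) p = \<chi> i *\<^sub>C p"
    and partner: "\<And>b. b \<in> T \<Longrightarrow> partner b \<in> sv_plus_index"
    and pairs: "\<And>b j M. b \<in> T \<Longrightarrow> M \<in> Poly_Mapping.keys p \<Longrightarrow> j \<in># M \<Longrightarrow> pairs_with b j"
    and outside: "\<And>b j M. b \<in> T \<Longrightarrow> M \<in> Poly_Mapping.keys p \<Longrightarrow> j \<in># M \<Longrightarrow> j \<notin> T \<Longrightarrow> pairing b j = 0"
    and outside_deg: "\<And>j M. M \<in> Poly_Mapping.keys p \<Longrightarrow> j \<in># M \<Longrightarrow> j \<notin> T \<Longrightarrow> deg_L j = 0"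
    and inj: "inj_on sv_index_num T"
    and nonpos: "\<And>b. b \<in> T \<Longrightarrow> sv_index_num b \<le> 0"
    and diagonal: "\<And>b. b \<in> T \<Longrightarrow> pairing b b \<noteq> 0"
    and M: "M \<in> Poly_Mapping.keys p"
  shows "set_mset M \<inter> T = {}"
proof (rule leading_term_elimination[where T = T and D = "\<lambda>b M. act (sv_basis (partner b)) (bvec M) - \<chi> (partner b) *\<^sub>C bvec M"
      and \<kappa> = "\<lambda>b. pairing b b * \<chi> (Ind_M 1)" and \<omega> = deg_L and height = "\<lambda>b. nat (- sv_index_num b)" and p = p])
  fix b assume b: "b \<in> T"
  let ?x = "sv_basis (partner b)"
  have "act ?x p = lin_ext (\<lambda>M. act ?x (bvec M)) p"
    using act_lin_ext_right[of ?x bvec p] by (simp add: lin_ext_bvec_self)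
  moreover have "\<chi> (partner b) *\<^sub>C p = lin_ext (\<lambda>M. \<chi> (partner b) *\<^sub>C bvec M) p"
    by (simp only: lin_ext_cscale_fun lin_ext_bvec_self)
  ultimately show "lin_ext (\<lambda>M. act ?x (bvec M) - \<chi> (partner b) *\<^sub>C bvec M) p = 0"
    using whittaker[OF partner[OF b]] by (simp add: lin_ext_diff_fun)
  show "pairing b b * \<chi> (Ind_M 1) \<noteq> 0" using diagonal[OF b] \<chi>_M1 by simp
next
  fix M assume "M \<in> Poly_Mapping.keys p" "set_mset M \<inter> T = {}"
  show "weight deg_L M = 0"
    using outside_deg[OF \<open>M \<in> Poly_Mapping.keys p\<close>] \<open>set_mset M \<inter> T = {}\<close> by auto
next
  fix b M assume b: "b \<in> T" and M: "M \<in> Poly_Mapping.keys p"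
  let ?x = "sv_basis (partner b)"
  have mono: "monomial M" using p M by blast
  have bracket_act: "act (bracket ?x (sv_basis j)) (bvec N) = pairing b j *\<^sub>C act (sv_M (sv_index_num j - sv_index_num b + 1)) (bvec N)"
    if "j \<in># M" for j N
    using bracket_partner[OF pairs[OF b M that]] by (simp add: act_cscale_left)
  have "Poly_Mapping.keys (act ?x (bvec M) - \<chi> (partner b) *\<^sub>C bvec M
      - (0 * of_nat (count M b)) *\<^sub>C bvec (M - {#b#})) \<subseteq> {N. weight deg_L N + deg_L b \<le> weight deg_L M}"
  proof (rule act_derivation[OF subadditive_deg_L partner[OF b] mono])
    fix j N assume j: "j \<in># M"
    have "Poly_Mapping.keys (act (sv_M (sv_index_num j - sv_index_num b + 1)) (bvec N)) \<subseteq> {K. weight deg_L K \<le> weight deg_L N}"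
      using keys_act[OF subadditive_deg_L, of "Ind_M ((sv_index_num j - sv_index_num b + 1))" N] by auto
    then have "Poly_Mapping.keys (pairing b j *\<^sub>C act (sv_M (sv_index_num j - sv_index_num b + 1)) (bvec N))
      \<subseteq> {K. weight deg_L K + deg_L b \<le> weight deg_L N + deg_L j}"
    proof (cases "pairing b j = 0")
      case False
      assume *: "Poly_Mapping.keys (act (sv_M (sv_index_num j - sv_index_num b + 1)) (bvec N)) \<subseteq> {K. weight deg_L K \<le> weight deg_L N}"
      show ?thesis using deg_L_pairing[OF False] by (intro keys_cscale_subset order.trans[OF *]) auto
    qed simp
    then show "Poly_Mapping.keys (act (bracket ?x (sv_basis j)) (bvec N) - (if j = b then 0 else 0) *\<^sub>C bvec N)
      \<subseteq> {K. weight deg_L K + deg_L b \<le> weight deg_L N + deg_L j}"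
      by (simp add: bracket_act[OF j])
  qed
  then show "Poly_Mapping.keys (act ?x (bvec M) - \<chi> (partner b) *\<^sub>C bvec M)
      \<subseteq> {N. weight deg_L N + deg_L b \<le> weight deg_L M}" by simp
  assume height: "\<forall>j\<in>set_mset M \<inter> T. nat (- sv_index_num j) \<le> nat (- sv_index_num b)"
  have "Poly_Mapping.keys (act ?x (bvec M) - \<chi> (partner b) *\<^sub>C bvec M
      - (pairing b b * \<chi> (Ind_M 1) * of_nat (count M b)) *\<^sub>C bvec (M - {#b#}))
      \<subseteq> {N. weight deg_L N + (deg_L b + 1) \<le> weight deg_L M}"
  proof (rule act_derivation[OF subadditive_deg_L partner[OF b] mono])
    fix j N assume j: "j \<in># M" and N: "N \<subseteq># M"
    have "monomial N" using mono mset_subset_eqD[OF N] by (auto simp: monomial_def)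
    let ?A = "{K. weight deg_L K + (deg_L b + 1) \<le> weight deg_L N + deg_L j}"
    show "Poly_Mapping.keys (act (bracket ?x (sv_basis j)) (bvec N)
        - (if j = b then pairing b b * \<chi> (Ind_M 1) else 0) *\<^sub>C bvec N) \<subseteq> ?A"
    proof (cases "pairing b j = 0")
      case True
      then show ?thesis using diagonal[OF b] by (auto simp: bracket_act[OF j])
    next
      case False
      define k where "k = sv_index_num j - sv_index_num b + 1"
      from False have "j \<in> T" using outside[OF b M j] by blast
      with height j have "nat (- sv_index_num j) \<le> nat (- sv_index_num b)" by blast
      with nonpos[OF b] have "k \<ge> 1" unfolding k_def by linarith
      moreover have "j = b \<longleftrightarrow> k = 1"
        using inj_on_eq_iff[OF inj \<open>j \<in> T\<close> b] unfolding k_def by linarith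
      ultimately have k: "k \<ge> 1" "k = 1 \<longleftrightarrow> j = b" by simp_all
      have scalar: "pairing b j *\<^sub>C \<chi> (Ind_M k) *\<^sub>C bvec N
          = (if j = b then pairing b b * \<chi> (Ind_M 1) else 0) *\<^sub>C bvec N"
      proof (cases "j = b")
        case True
        with k(2) show ?thesis by (simp add: cscale_cscale)
      next
        case False
        with k have "k \<ge> 2" by force
        from False \<chi>_M[OF this] show ?thesis by simp
      qed
      have "act (bracket ?x (sv_basis j)) (bvec N) - (if j = b then pairing b b * \<chi> (Ind_M 1) else 0) *\<^sub>C bvec N
          = pairing b j *\<^sub>C (act (sv_M k) (bvec N) - \<chi> (Ind_M k) *\<^sub>C bvec N)"
        by (simp only: bracket_act[OF j] cvs.scale_right_diff_distrib scalar flip: k_def)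
      moreover have "Poly_Mapping.keys \<dots> \<subseteq> ?A"
        using deg_L_pairing[OF False]
        by (intro keys_cscale_subset order.trans[OF act_M_bvec[OF k(1) \<open>monomial N\<close>]]) auto
      ultimately show ?thesis by (simp only:)
    qed
  qed
  then show "Poly_Mapping.keys (act ?x (bvec M) - \<chi> (partner b) *\<^sub>C bvec M
      - (pairing b b * \<chi> (Ind_M 1) * of_nat (count M b)) *\<^sub>C bvec (M - {#b#}))
      \<subseteq> {N. weight deg_L N + deg_L b < weight deg_L M}"
    by (simp add: Suc_le_eq)
qed (rule M)

text \<open>The three stages. The index of \<open>M\<^sub>0\<close> stays, its pairing with every partner being zero.\<close>

lemma whittaker_support:
  assumes \<chi>_M1: "\<chi> (Ind_M 1) \<noteq> 0" and \<chi>_M: "\<And>m. m \<ge> 2 \<Longrightarrow> \<chi> (Ind_M m) = 0"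
    and p: "Poly_Mapping.keys p \<subseteq> Collect monomial"
    and whittaker: "\<And>i. i \<in> sv_plus_index \<Longrightarrow> act (sv_basis i) p = \<chi> i *\<^sub>C p"
    and M: "M \<in> Poly_Mapping.keys p"
  shows "M = replicate_mset (size M) (Ind_M 0)"
proof -
  note eliminate = whittaker_support_disjoint[OF \<chi>_M1 \<chi>_M p whittaker]
  have neg: "j \<notin> sv_plus_index" if "M \<in> Poly_Mapping.keys p" "j \<in># M" for M j
    using p that unfolding monomial_def by blast
  have no_L: "Ind_L n \<notin># M" if "M \<in> Poly_Mapping.keys p" for M n
  proof -
    have "set_mset M \<inter> {Ind_L n | n. n \<le> 0} = {}"
    proof (rule eliminate)
      show "deg_L j = 0" if "M \<in> Poly_Mapping.keys p" "j \<in># M" "j \<notin> {Ind_L n | n. n \<le> 0}" for j M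
        using that neg[of M j] by (cases j) (auto simp: sv_plus_index_simps)
      show "pairing b j = 0" if "b \<in> {Ind_L n | n. n \<le> 0}" "M \<in> Poly_Mapping.keys p" "j \<in># M" "j \<notin> {Ind_L n | n. n \<le> 0}" for b j M
        using that neg[of M j] by (cases j) (auto simp: sv_plus_index_simps)
    qed (use that in \<open>auto simp: sv_plus_index_simps inj_on_def\<close>)
    then show ?thesis using neg[OF that, of "Ind_L n"] by (auto simp: sv_plus_index_simps)
  qed
  have no_Y: "Ind_Y n \<notin># M" if "M \<in> Poly_Mapping.keys p" for M n
  proof -
    have "set_mset M \<inter> {Ind_Y n | n. n \<le> -1} = {}"
    proof (rule eliminate)
      show "deg_L j = 0" if "M \<in> Poly_Mapping.keys p" "j \<in># M" for j M
        using that no_L[of M] by (cases j) auto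
      show "pairing b j = 0" if "b \<in> {Ind_Y n | n. n \<le> -1}" "M \<in> Poly_Mapping.keys p" "j \<in># M" "j \<notin> {Ind_Y n | n. n \<le> -1}" for b j M
        using that neg[of M j] by (cases j) (auto simp: sv_plus_index_simps)
      show "pairs_with b j" if "b \<in> {Ind_Y n | n. n \<le> -1}" "M \<in> Poly_Mapping.keys p" "j \<in># M" for b j M
        using that no_L[of M] by auto
    qed (use that in \<open>auto simp: sv_plus_index_simps inj_on_def\<close>)
    then show ?thesis using neg[OF that, of "Ind_Y n"] by (auto simp: sv_plus_index_simps)
  qed
  have only_M: "\<exists>n\<le>0. j = Ind_M n" if "M \<in> Poly_Mapping.keys p" "j \<in># M" for M j
    using no_L[OF that(1)] no_Y[OF that(1)] neg[OF that] that(2) by (cases j) (auto simp: sv_plus_index_simps)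
  have "set_mset M \<inter> {Ind_M n | n. n \<le> -1} = {}"
  proof (rule eliminate)
    show "deg_L j = 0" if "M \<in> Poly_Mapping.keys p" "j \<in># M" for j M
      using only_M[OF that] by auto
    show "pairing b j = 0" if "b \<in> {Ind_M n | n. n \<le> -1}" "M \<in> Poly_Mapping.keys p" "j \<in># M" "j \<notin> {Ind_M n | n. n \<le> -1}" for b j M
      using that(1,4) only_M[OF that(2,3)] by force
    show "pairs_with b j" if "b \<in> {Ind_M n | n. n \<le> -1}" "M \<in> Poly_Mapping.keys p" "j \<in># M" for b j M
      using that(1) only_M[OF that(2,3)] by auto
  qed (use M in \<open>auto simp: sv_plus_index_simps inj_on_def\<close>)
  then have "j = Ind_M 0" if "j \<in># M" for j
    using only_M[OF M that] that by force
  then have "set_mset M \<subseteq> {Ind_M 0}" by blast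
  then show ?thesis by (rule set_mset_subset_singletonD)
qed

lemma U_monomial_replicate_M0: "U_monomial (replicate_mset k (Ind_M 0)) \<in> M0_polys"
proof -
  have M0: "uea_of (sv_M 0) \<in> M0_polys" unfolding M0_polys_def by (rule hull_inc) simp
  show ?thesis
  proof (induction k)
    case 0
    then show ?case using is_subalgebra_M0_polys by (simp add: U_monomial_empty is_subalgebra_def)
  next
    case (Suc k)
    have "U_monomial (replicate_mset (Suc k) (Ind_M 0))
        = uea_of (sv_M 0) * U_monomial (replicate_mset k (Ind_M 0))"
      by (simp add: U_monomial_add_mset)
    then show ?case using Suc M0 is_subalgebra_M0_polys by (simp add: is_subalgebra_def)
  qed
qed

end

theorem theorem3p5:
  fixes \<psi> :: "sv_plus \<Rightarrow> complex" and v :: whittaker_vec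
  assumes "lie_hom \<psi>"
    and "\<And>n. n \<ge> 3 \<Longrightarrow> \<psi> (to_sv_plus (sv_L n)) = 0"
    and "\<And>m. m \<ge> 2 \<Longrightarrow> \<psi> (to_sv_plus (sv_M m)) = 0"
    and "\<And>k. k \<ge> 1 \<Longrightarrow> \<psi> (to_sv_plus (sv_Y k)) = 0"
    and "\<psi> (to_sv_plus (sv_M 1)) \<noteq> 0"
    and "v \<in> whittaker_module \<psi>"
  shows "is_whittaker_vector \<psi> v \<longleftrightarrow> (\<exists>u\<in>M0_polys. v = whittaker_act \<psi> u (whittaker_gen \<psi>))"
proof -
  interpret whittaker_type \<psi> using assms(1) by unfold_locales
  have gen: "whittaker_act \<psi> u (whittaker_gen \<psi>) = tens u" for u
    by (simp add: whittaker_gen_def whittaker_act_pure_tensor)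
  show ?thesis
  proof
    assume whittaker: "is_whittaker_vector \<psi> v"
    obtain u where u: "v = tens u" using whittaker_module_tens[OF assms(6)] .
    define p where "p = U_act u vac"
    have M0: "M = replicate_mset (size M) (Ind_M 0)" if "M \<in> Poly_Mapping.keys p" for M
    proof (rule whittaker_support[OF _ _ _ _ that])
      show "Poly_Mapping.keys p \<subseteq> Collect monomial" unfolding p_def by (rule monomial_U_act)
      show "act (sv_basis i) p = \<chi> i *\<^sub>C p" if "i \<in> sv_plus_index" for i
        using whittaker that unfolding u p_def by (rule act_whittaker_vector)
    qed (use assms(3,5) in \<open>simp_all add: \<chi>_def\<close>)
    have "U_monomial M \<in> M0_polys" if "M \<in> Poly_Mapping.keys p" for M
      by (subst M0[OF that]) (rule U_monomial_replicate_M0)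
    then have "lin_ext U_monomial p \<in> M0_polys"
      using is_subalgebra_M0_polys unfolding lin_ext_def is_subalgebra_def
      by (intro cvs.subspace_sum cvs.subspace_scale) auto
    moreover have "v = tens (lin_ext U_monomial p)" unfolding u p_def by (rule tens_section)
    ultimately show "\<exists>u\<in>M0_polys. v = whittaker_act \<psi> u (whittaker_gen \<psi>)" by (auto simp: gen)
  next
    assume "\<exists>u\<in>M0_polys. v = whittaker_act \<psi> u (whittaker_gen \<psi>)"
    then obtain u where "u \<in> M0_polys" "v = tens u" by (auto simp: gen)
    then show "is_whittaker_vector \<psi> v"
      by (simp add: is_whittaker_vector_tens M0_polys_central tens_uea_of)
  qed
qed

end
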